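(* Let $\mathcal F:\mathsf{AOLie}\to\mathsf{RBOLeibnizA}$ be the functor which sends a relative averaging operator $T:V\to\mathfrak g$ on a Lie algebra $(\mathfrak g,[-,-]_{\mathfrak g})$ with respect to a representation $(V;\rho)$ to the same map $T:V\to\mathfrak g$, viewed as a relative Rota-Baxter operator on $(\mathfrak g,[-,-]_{\mathfrak g})$ regarded as a Leibniz algebra, with respect to the antisymmetric representation $(V;\rho,0)$, and which sends a homomorphism $(\phi,\varphi)$ to $(\phi,\varphi)$. Then there is a functor $\mathcal G$ from the category $\mathsf{RBOLeibnizA}$ of relative Rota-Baxter operators on Leibniz algebras with respect to antisymmetric representations to the category $\mathsf{AOLie}$ of relative averaging operators on Lie algebras, such that $\mathcal G$ is a left adjoint for $\mathcal F$.
   Context: All vector spaces are finite-dimensional over an algebraically closed field $\mathbb K$ of characteristic $0$. A (left) Leibniz algebra is a vector space $\mathfrak G$ with a bilinear operation $[-,-]_{\mathfrak G}$ such that $[x,[y,z]_{\mathfrak G}]_{\mathfrak G}=[[x,y]_{\mathfrak G},z]_{\mathfrak G}+[y,[x,z]_{\mathfrak G}]_{\mathfrak G}$ for all $x,y,z$. A representation of $\mathfrak G$ is a triple $(V;\rho^L,\rho^R)$ with $V$ a vector space and $\rho^L,\rho^R:\mathfrak G\to\mathfrak{gl}(V)$ linear such that for all $x,y\in\mathfrak G$: $\rho^L([x,y]_{\mathfrak G})=[\rho^L(x),\rho^L(y)]$, $\rho^R([x,y]_{\mathfrak G})=[\rho^L(x),\rho^R(y)]$, $\rho^R(y)\circ\rho^L(x)=-\rho^R(y)\circ\rho^R(x)$.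 It is antisymmetric if $\rho^R=0$. Category $\mathsf{AOLie}$: objects are relative averaging operators on Lie algebras, i.e. linear maps $T:V\to\mathfrak g$, where $(V;\rho)$ is a representation of a Lie algebra $\mathfrak g$, with $[Tu,Tv]_{\mathfrak g}=T(\rho(Tu)v)$ for all $u,v\in V$. A morphism from $T:V\to\mathfrak g$ to $T':V'\to\mathfrak g'$ is a pair $(\phi,\varphi)$ with $\phi:\mathfrak g\to\mathfrak g'$ a Lie algebra homomorphism and $\varphi:V\to V'$ linear such that $T'\circ\varphi=\phi\circ T$ and $\varphi(\rho(x)u)=\rho'(\phi(x))\varphi(u)$ for all $x\in\mathfrak g$, $u\in V$. Category $\mathsf{RBOLeibnizA}$: objects are linear maps $T:V\to\mathfrak G$, where $(V;\rho^L,\rho^R)$ is an antisymmetric representation of a Leibniz algebra $\mathfrak G$, with $[Tu,Tv]_{\mathfrak G}=T(\rho^L(Tu)v+\rho^R(Tv)u)$ for all $u,v\in V$. A morphism from $T:V\to\mathfrak G$ to $T':V'\to\mathfrak G'$ is a pair $(\phi,\varphi)$ with $\phi:\mathfrak G\to\mathfrak G'$ a Leibniz algebra homomorphism and $\varphi:V\to V'$ linear such that $T'\circ\varphi=\phi\circ T$, $\varphi(\rho^L(x)u)={\rho^L}'(\phi(x))\varphi(u)$ and $\varphi(\rho^R(x)u)={\rho^R}'(\phi(x))\varphi(u)$ for all $x\in\mathfrak G$, $u\in V$. *)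

theory Defs
  imports "Jordan_Normal_Form.Missing_VectorSpace" "HOL-Algebra.Algebraic_Closure"
begin

hide_const (open) Modules.module_hom

section \<open>Categories, functors and adjunctions\<close>

text \<open>A category is given by a set of objects and a family of Hom sets, which need not be
  disjoint; so identities, composition and the action of a functor on morphisms are indexed by
  objects. \<open>Comp C x y z g f\<close> is the composite of \<open>f : x \<rightarrow> y\<close> and \<open>g : y \<rightarrow> z\<close>.\<close>

record ('o, 'm) category_data =
  Ob :: "'o set"
  Hom :: "'o \<Rightarrow> 'o \<Rightarrow> 'm set"
  Id :: "'o \<Rightarrow> 'm"
  Comp :: "'o \<Rightarrow> 'o \<Rightarrow> 'o \<Rightarrow> 'm \<Rightarrow> 'm \<Rightarrow> 'm"

locale category =
  fixes C :: "('o, 'm) category_data"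
  assumes Id_in: "x \<in> Ob C \<Longrightarrow> Id C x \<in> Hom C x x"
    and Comp_in: "\<lbrakk>x \<in> Ob C; y \<in> Ob C; z \<in> Ob C; f \<in> Hom C x y; g \<in> Hom C y z\<rbrakk>
      \<Longrightarrow> Comp C x y z g f \<in> Hom C x z"
    and Comp_Id_right: "\<lbrakk>x \<in> Ob C; y \<in> Ob C; f \<in> Hom C x y\<rbrakk> \<Longrightarrow> Comp C x x y f (Id C x) = f"
    and Comp_Id_left: "\<lbrakk>x \<in> Ob C; y \<in> Ob C; f \<in> Hom C x y\<rbrakk> \<Longrightarrow> Comp C x y y (Id C y) f = f"
    and Comp_assoc: "\<lbrakk>w \<in> Ob C; x \<in> Ob C; y \<in> Ob C; z \<in> Ob C;
        f \<in> Hom C w x; g \<in> Hom C x y; h \<in> Hom C y z\<rbrakk>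
      \<Longrightarrow> Comp C w x z (Comp C x y z h g) f = Comp C w y z h (Comp C w x y g f)"

record ('o1, 'm1, 'o2, 'm2) functor_data =
  obj_map :: "'o1 \<Rightarrow> 'o2"
  arr_map :: "'o1 \<Rightarrow> 'o1 \<Rightarrow> 'm1 \<Rightarrow> 'm2"

locale is_functor = source: category C + target: category D
  for C :: "('o1, 'm1) category_data"
    and D :: "('o2, 'm2) category_data"
    and F :: "('o1, 'm1, 'o2, 'm2) functor_data" +
  assumes obj_map_in: "x \<in> Ob C \<Longrightarrow> obj_map F x \<in> Ob D"
    and arr_map_in: "\<lbrakk>x \<in> Ob C; y \<in> Ob C; f \<in> Hom C x y\<rbrakk>
      \<Longrightarrow> arr_map F x y f \<in> Hom D (obj_map F x) (obj_map F y)"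
    and arr_map_Id: "x \<in> Ob C \<Longrightarrow> arr_map F x x (Id C x) = Id D (obj_map F x)"
    and arr_map_Comp: "\<lbrakk>x \<in> Ob C; y \<in> Ob C; z \<in> Ob C; f \<in> Hom C x y; g \<in> Hom C y z\<rbrakk>
      \<Longrightarrow> arr_map F x z (Comp C x y z g f) =
          Comp D (obj_map F x) (obj_map F y) (obj_map F z) (arr_map F y z g) (arr_map F x y f)"

text \<open>\<open>\<Phi> x y\<close> is the bijection \<open>Hom\<^sub>C (G x) y \<cong> Hom\<^sub>D x (F y)\<close>;
  \<open>Phi_natural\<close> is naturality in both variables at once.\<close>

locale adjunction = F: is_functor C D F + G: is_functor D C G
  for C :: "('o1, 'm1) category_data"
    and D :: "('o2, 'm2) category_data"
    and F :: "('o1, 'm1, 'o2, 'm2) functor_data"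
    and G :: "('o2, 'm2, 'o1, 'm1) functor_data" +
  fixes \<Phi> :: "'o2 \<Rightarrow> 'o1 \<Rightarrow> 'm1 \<Rightarrow> 'm2"
  assumes Phi_bij: "\<lbrakk>x \<in> Ob D; y \<in> Ob C\<rbrakk>
      \<Longrightarrow> bij_betw (\<Phi> x y) (Hom C (obj_map G x) y) (Hom D x (obj_map F y))"
    and Phi_natural: "\<lbrakk>x \<in> Ob D; x' \<in> Ob D; y \<in> Ob C; y' \<in> Ob C;
        a \<in> Hom D x' x; h \<in> Hom C (obj_map G x) y; b \<in> Hom C y y'\<rbrakk>
      \<Longrightarrow> \<Phi> x' y' (Comp C (obj_map G x') y y' b
              (Comp C (obj_map G x') (obj_map G x) y h (arr_map G x' x a))) =
          Comp D x' (obj_map F y) (obj_map F y') (arr_map F y y' b)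
              (Comp D x' x (obj_map F y) (\<Phi> x y h) a)"

definition left_adjoint where
  "left_adjoint C D F G \<longleftrightarrow> (\<exists>\<Phi>. adjunction C D F G \<Phi>)"
  \<comment> \<open>\<open>G : D \<rightarrow> C\<close> is left adjoint to \<open>F : C \<rightarrow> D\<close>\<close>


section \<open>Lie algebras, Leibniz algebras and their representations\<close>

definition bilinear_on where
  "bilinear_on K A B C f \<longleftrightarrow>
     (\<forall>x\<in>carrier A. f x \<in> module_hom K B C) \<and>
     (\<forall>y\<in>carrier B. (\<lambda>x. f x y) \<in> module_hom K A C)"

locale fin_dim_vectorspace = vectorspace K V for K (structure) and V (structure) +
  assumes finite_dimensional: "fin_dim"

text \<open>The multiplication and unit fields that \<open>module\<close> inherits from \<open>ring\<close> carry no meaning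
  here, as for every vector space in HOL-Algebra style.\<close>

record ('k, 'g) bracket_space = "('k, 'g) module" +
  bracket :: "'g \<Rightarrow> 'g \<Rightarrow> 'g"

locale leibniz_algebra = fin_dim_vectorspace K \<gg>
  for K :: "('k, 'r) ring_scheme" (structure) and \<gg> :: "('k, 'g) bracket_space" +
  assumes bracket_bilinear: "bilinear_on K \<gg> \<gg> \<gg> (bracket \<gg>)"
    and left_leibniz: "\<lbrakk>x \<in> carrier \<gg>; y \<in> carrier \<gg>; z \<in> carrier \<gg>\<rbrakk> \<Longrightarrow>
      bracket \<gg> x (bracket \<gg> y z) =
        bracket \<gg> (bracket \<gg> x y) z \<oplus>\<^bsub>\<gg>\<^esub> bracket \<gg> y (bracket \<gg> x z)"

locale lie_algebra = fin_dim_vectorspace K \<gg>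
  for K :: "('k, 'r) ring_scheme" (structure) and \<gg> :: "('k, 'g) bracket_space" +
  assumes bracket_bilinear: "bilinear_on K \<gg> \<gg> \<gg> (bracket \<gg>)"
    and alternating: "x \<in> carrier \<gg> \<Longrightarrow> bracket \<gg> x x = \<zero>\<^bsub>\<gg>\<^esub>"
    and jacobi: "\<lbrakk>x \<in> carrier \<gg>; y \<in> carrier \<gg>; z \<in> carrier \<gg>\<rbrakk> \<Longrightarrow>
      bracket \<gg> x (bracket \<gg> y z) \<oplus>\<^bsub>\<gg>\<^esub> bracket \<gg> y (bracket \<gg> z x)
        \<oplus>\<^bsub>\<gg>\<^esub> bracket \<gg> z (bracket \<gg> x y) = \<zero>\<^bsub>\<gg>\<^esub>"

text \<open>A linear map \<open>\<gg> \<rightarrow> gl(V)\<close> is the same thing as a bilinear map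
  \<open>\<gg> \<times> V \<rightarrow> V\<close>; identities in \<open>gl(V)\<close> are written out on vectors.\<close>

locale lie_representation = lie_algebra K \<gg> + V: fin_dim_vectorspace K V
  for K :: "('k, 'r) ring_scheme" (structure) and \<gg> :: "('k, 'g) bracket_space"
    and V :: "('k, 'v) module" +
  fixes \<rho> :: "'g \<Rightarrow> 'v \<Rightarrow> 'v"
  assumes rho_bilinear: "bilinear_on K \<gg> V V \<rho>"
    and rho_bracket: "\<lbrakk>x \<in> carrier \<gg>; y \<in> carrier \<gg>; v \<in> carrier V\<rbrakk> \<Longrightarrow>
      \<rho> (bracket \<gg> x y) v = \<rho> x (\<rho> y v) \<ominus>\<^bsub>V\<^esub> \<rho> y (\<rho> x v)"

locale leibniz_representation = leibniz_algebra K \<gg> + V: fin_dim_vectorspace K V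
  for K :: "('k, 'r) ring_scheme" (structure) and \<gg> :: "('k, 'g) bracket_space"
    and V :: "('k, 'v) module" +
  fixes \<rho>L \<rho>R :: "'g \<Rightarrow> 'v \<Rightarrow> 'v"
  assumes rhoL_bilinear: "bilinear_on K \<gg> V V \<rho>L"
    and rhoR_bilinear: "bilinear_on K \<gg> V V \<rho>R"
    and rhoL_bracket: "\<lbrakk>x \<in> carrier \<gg>; y \<in> carrier \<gg>; v \<in> carrier V\<rbrakk> \<Longrightarrow>
      \<rho>L (bracket \<gg> x y) v = \<rho>L x (\<rho>L y v) \<ominus>\<^bsub>V\<^esub> \<rho>L y (\<rho>L x v)"
    and rhoR_bracket: "\<lbrakk>x \<in> carrier \<gg>; y \<in> carrier \<gg>; v \<in> carrier V\<rbrakk> \<Longrightarrow>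
      \<rho>R (bracket \<gg> x y) v = \<rho>L x (\<rho>R y v) \<ominus>\<^bsub>V\<^esub> \<rho>R y (\<rho>L x v)"
    and rhoR_rhoL: "\<lbrakk>x \<in> carrier \<gg>; y \<in> carrier \<gg>; v \<in> carrier V\<rbrakk> \<Longrightarrow>
      \<rho>R y (\<rho>L x v) = \<ominus>\<^bsub>V\<^esub> (\<rho>R y (\<rho>R x v))"

locale antisymmetric_representation = leibniz_representation K \<gg> V \<rho>L \<rho>R
  for K :: "('k, 'r) ring_scheme" (structure) and \<gg> :: "('k, 'g) bracket_space"
    and V :: "('k, 'v) module" and \<rho>L \<rho>R +
  assumes rhoR_zero: "\<lbrakk>x \<in> carrier \<gg>; v \<in> carrier V\<rbrakk> \<Longrightarrow> \<rho>R x v = \<zero>\<^bsub>V\<^esub>"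

definition bracket_hom where
  "bracket_hom K \<gg> \<hh> = {\<phi> \<in> module_hom K \<gg> \<hh>.
     \<forall>x\<in>carrier \<gg>. \<forall>y\<in>carrier \<gg>. \<phi> (bracket \<gg> x y) = bracket \<hh> (\<phi> x) (\<phi> y)}"


section \<open>The two categories\<close>

text \<open>The carriers of \<open>\<gg>\<close> and \<open>V\<close> are arbitrary subsets of the types \<open>'g\<close> and \<open>'v\<close>, with
  arbitrary operations on them; these types play the role of universes.
  Morphisms are pairs of maps on carriers. They are taken to be extensional, so that
  equality of morphisms is equality of the underlying maps on the carriers.\<close>

definition pair_id where
  "pair_id \<gg> V = ((\<lambda>x\<in>carrier \<gg>. x), (\<lambda>u\<in>carrier V. u))"

definition pair_comp where
  "pair_comp \<gg> V g f = (compose (carrier \<gg>) (fst g) (fst f), compose (carrier V) (snd g) (snd f))"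

record ('k, 'g, 'v) averaging_op =
  ao_alg :: "('k, 'g) bracket_space"
  ao_mod :: "('k, 'v) module"
  ao_rho :: "'g \<Rightarrow> 'v \<Rightarrow> 'v"
  ao_op :: "'v \<Rightarrow> 'g"

definition averaging_operator ::
  "('k, 'r) ring_scheme \<Rightarrow> ('k, 'g, 'v) averaging_op \<Rightarrow> bool" where
  "averaging_operator K A \<longleftrightarrow>
     lie_representation K (ao_alg A) (ao_mod A) (ao_rho A) \<and>
     ao_op A \<in> module_hom K (ao_mod A) (ao_alg A) \<and>
     (\<forall>u\<in>carrier (ao_mod A). \<forall>v\<in>carrier (ao_mod A).
        bracket (ao_alg A) (ao_op A u) (ao_op A v) = ao_op A (ao_rho A (ao_op A u) v))"

definition averaging_hom ::
  "('k, 'r) ring_scheme \<Rightarrow> ('k, 'g, 'v) averaging_op \<Rightarrow> ('k, 'g, 'v) averaging_op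
     \<Rightarrow> (('g \<Rightarrow> 'g) \<times> ('v \<Rightarrow> 'v)) set" where
  "averaging_hom K A A' = {(\<phi>, \<psi>).
     \<phi> \<in> bracket_hom K (ao_alg A) (ao_alg A') \<inter> extensional (carrier (ao_alg A)) \<and>
     \<psi> \<in> module_hom K (ao_mod A) (ao_mod A') \<inter> extensional (carrier (ao_mod A)) \<and>
     (\<forall>u\<in>carrier (ao_mod A). ao_op A' (\<psi> u) = \<phi> (ao_op A u)) \<and>
     (\<forall>x\<in>carrier (ao_alg A). \<forall>u\<in>carrier (ao_mod A).
        \<psi> (ao_rho A x u) = ao_rho A' (\<phi> x) (\<psi> u))}"

definition AOLie ::
  "('k, 'r) ring_scheme
     \<Rightarrow> (('k, 'g, 'v) averaging_op, ('g \<Rightarrow> 'g) \<times> ('v \<Rightarrow> 'v)) category_data" where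
  "AOLie K = \<lparr>Ob = {A. averaging_operator K A},
     Hom = averaging_hom K,
     Id = (\<lambda>A. pair_id (ao_alg A) (ao_mod A)),
     Comp = (\<lambda>A _ _. pair_comp (ao_alg A) (ao_mod A))\<rparr>"

record ('k, 'g, 'v) rota_baxter_op =
  rb_alg :: "('k, 'g) bracket_space"
  rb_mod :: "('k, 'v) module"
  rb_rhoL :: "'g \<Rightarrow> 'v \<Rightarrow> 'v"
  rb_rhoR :: "'g \<Rightarrow> 'v \<Rightarrow> 'v"
  rb_op :: "'v \<Rightarrow> 'g"

definition antisym_rota_baxter_operator ::
  "('k, 'r) ring_scheme \<Rightarrow> ('k, 'g, 'v) rota_baxter_op \<Rightarrow> bool" where
  "antisym_rota_baxter_operator K B \<longleftrightarrow>
     antisymmetric_representation K (rb_alg B) (rb_mod B) (rb_rhoL B) (rb_rhoR B) \<and>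
     rb_op B \<in> module_hom K (rb_mod B) (rb_alg B) \<and>
     (\<forall>u\<in>carrier (rb_mod B). \<forall>v\<in>carrier (rb_mod B).
        bracket (rb_alg B) (rb_op B u) (rb_op B v) =
          rb_op B (rb_rhoL B (rb_op B u) v \<oplus>\<^bsub>rb_mod B\<^esub> rb_rhoR B (rb_op B v) u))"

definition rota_baxter_hom ::
  "('k, 'r) ring_scheme \<Rightarrow> ('k, 'g, 'v) rota_baxter_op \<Rightarrow> ('k, 'g, 'v) rota_baxter_op
     \<Rightarrow> (('g \<Rightarrow> 'g) \<times> ('v \<Rightarrow> 'v)) set" where
  "rota_baxter_hom K B B' = {(\<phi>, \<psi>).
     \<phi> \<in> bracket_hom K (rb_alg B) (rb_alg B') \<inter> extensional (carrier (rb_alg B)) \<and>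
     \<psi> \<in> module_hom K (rb_mod B) (rb_mod B') \<inter> extensional (carrier (rb_mod B)) \<and>
     (\<forall>u\<in>carrier (rb_mod B). rb_op B' (\<psi> u) = \<phi> (rb_op B u)) \<and>
     (\<forall>x\<in>carrier (rb_alg B). \<forall>u\<in>carrier (rb_mod B).
        \<psi> (rb_rhoL B x u) = rb_rhoL B' (\<phi> x) (\<psi> u)) \<and>
     (\<forall>x\<in>carrier (rb_alg B). \<forall>u\<in>carrier (rb_mod B).
        \<psi> (rb_rhoR B x u) = rb_rhoR B' (\<phi> x) (\<psi> u))}"

definition RBOLeibnizA ::
  "('k, 'r) ring_scheme
     \<Rightarrow> (('k, 'g, 'v) rota_baxter_op, ('g \<Rightarrow> 'g) \<times> ('v \<Rightarrow> 'v)) category_data" where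
  "RBOLeibnizA K = \<lparr>Ob = {B. antisym_rota_baxter_operator K B},
     Hom = rota_baxter_hom K,
     Id = (\<lambda>B. pair_id (rb_alg B) (rb_mod B)),
     Comp = (\<lambda>B _ _. pair_comp (rb_alg B) (rb_mod B))\<rparr>"

definition AO_to_RBO ::
  "(('k, 'g, 'v) averaging_op, ('g \<Rightarrow> 'g) \<times> ('v \<Rightarrow> 'v),
    ('k, 'g, 'v) rota_baxter_op, ('g \<Rightarrow> 'g) \<times> ('v \<Rightarrow> 'v)) functor_data" where
  "AO_to_RBO = \<lparr>
     obj_map = (\<lambda>A. \<lparr>rb_alg = ao_alg A, rb_mod = ao_mod A, rb_rhoL = ao_rho A,
                      rb_rhoR = (\<lambda>x u. \<zero>\<^bsub>ao_mod A\<^esub>), rb_op = ao_op A\<rparr>),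
     arr_map = (\<lambda>A A' f. f)\<rparr>"

end

theory Submission
  imports Defs
begin

text \<open>The span of the squares \<open>[x,x]\<close> of a Leibniz algebra \<open>\<gg>\<close> is an ideal, and the quotient
  \<open>\<gg>\<^sub>L\<^sub>i\<^sub>e\<close> is the universal Lie algebra under \<open>\<gg>\<close>. Since \<open>\<rho>\<^sup>L([x,x]) = [\<rho>\<^sup>L(x),\<rho>\<^sup>L(x)] = 0\<close>, the
  left action descends to \<open>\<gg>\<^sub>L\<^sub>i\<^sub>e\<close>, and because \<open>\<rho>\<^sup>R = 0\<close> the Rota-Baxter identity says precisely that
  \<open>V \<rightarrow> \<gg> \<rightarrow> \<gg>\<^sub>L\<^sub>i\<^sub>e\<close> is an averaging operator. The quotient map together with the identity of \<open>V\<close> is a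
  universal arrow, so sending \<open>V \<rightarrow> \<gg>\<close> to \<open>V \<rightarrow> \<gg>\<^sub>L\<^sub>i\<^sub>e\<close> defines the left adjoint.\<close>


section \<open>Left adjoints from universal arrows\<close>

text \<open>Pointwise data for a left adjoint: an object \<open>G\<^sub>0 x\<close>, an arrow
  \<open>\<eta> x\<close> into its image under \<open>F\<close>, and a factorisation
  \<open>lift\<close>. \<open>lift_unit\<close> is existence and \<open>lift_unique\<close> is
  uniqueness of the factorisation, the latter phrased as an equation saying that \<open>lift\<close>
  undoes composition with the unit. Functoriality of \<open>G\<^sub>0\<close> and naturality of
  \<open>\<eta>\<close> are conclusions.\<close>

locale universal_arrows = is_functor C D F
  for C :: "('o1, 'm1) category_data"
    and D :: "('o2, 'm2) category_data"
    and F :: "('o1, 'm1, 'o2, 'm2) functor_data" +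
  fixes G\<^sub>0 :: "'o2 \<Rightarrow> 'o1" and \<eta> :: "'o2 \<Rightarrow> 'm2" and lift :: "'o2 \<Rightarrow> 'o1 \<Rightarrow> 'm2 \<Rightarrow> 'm1"
  assumes G0_in: "x \<in> Ob D \<Longrightarrow> G\<^sub>0 x \<in> Ob C"
    and unit_in: "x \<in> Ob D \<Longrightarrow> \<eta> x \<in> Hom D x (obj_map F (G\<^sub>0 x))"
    and lift_in: "\<lbrakk>x \<in> Ob D; y \<in> Ob C; f \<in> Hom D x (obj_map F y)\<rbrakk>
      \<Longrightarrow> lift x y f \<in> Hom C (G\<^sub>0 x) y"
    and lift_unit: "\<lbrakk>x \<in> Ob D; y \<in> Ob C; f \<in> Hom D x (obj_map F y)\<rbrakk>
      \<Longrightarrow> Comp D x (obj_map F (G\<^sub>0 x)) (obj_map F y) (arr_map F (G\<^sub>0 x) y (lift x y f)) (\<eta> x) = f"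
    and lift_unique: "\<lbrakk>x \<in> Ob D; y \<in> Ob C; h \<in> Hom C (G\<^sub>0 x) y\<rbrakk>
      \<Longrightarrow> lift x y (Comp D x (obj_map F (G\<^sub>0 x)) (obj_map F y) (arr_map F (G\<^sub>0 x) y h) (\<eta> x)) = h"
begin

text \<open>Naturality of the unit forces the action on arrows: \<open>f\<close> must go to the
  factorisation of \<open>\<eta> x'\<close> after \<open>f\<close>.\<close>

definition adjoint :: "('o2, 'm2, 'o1, 'm1) functor_data" where
  "adjoint = \<lparr>
     obj_map = G\<^sub>0,
     arr_map = (\<lambda>x x' f. lift x (G\<^sub>0 x') (Comp D x x' (obj_map F (G\<^sub>0 x')) (\<eta> x') f))\<rparr>"

lemma obj_map_adjoint [simp]: "obj_map adjoint = G\<^sub>0"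
  by (simp add: adjoint_def)

lemma arr_map_adjoint_in:
  assumes "x \<in> Ob D" "x' \<in> Ob D" "f \<in> Hom D x x'"
  shows "arr_map adjoint x x' f \<in> Hom C (G\<^sub>0 x) (G\<^sub>0 x')"
  using assms
  by (simp add: adjoint_def lift_in target.Comp_in[of x x'] G0_in obj_map_in unit_in)

text \<open>This is \<open>lift_unit\<close> for the arrow whose lift defines
  \<open>arr_map adjoint\<close>.\<close>

lemma unit_natural:
  assumes "x \<in> Ob D" "x' \<in> Ob D" "f \<in> Hom D x x'"
  shows "Comp D x (obj_map F (G\<^sub>0 x)) (obj_map F (G\<^sub>0 x'))
      (arr_map F (G\<^sub>0 x) (G\<^sub>0 x') (arr_map adjoint x x' f)) (\<eta> x) =
    Comp D x x' (obj_map F (G\<^sub>0 x')) (\<eta> x') f"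
  using assms
  by (simp add: adjoint_def lift_unit target.Comp_in[of x x'] G0_in obj_map_in unit_in)

text \<open>By \<open>lift_unique\<close>, an arrow out of \<open>G\<^sub>0 x\<close> is determined
  by its image under \<open>F\<close> precomposed with \<open>\<eta> x\<close>. The laws for
  identities and composites are therefore checked on these composites in \<open>D\<close>.\<close>

lemma is_functor_adjoint: "is_functor D C adjoint"
proof
  fix x assume x: "x \<in> Ob D"
  then show "obj_map adjoint x \<in> Ob C" by (simp add: G0_in)
  show "arr_map adjoint x x (Id D x) = Id C (obj_map adjoint x)"
    using lift_unique[OF x G0_in[OF x] source.Id_in[OF G0_in[OF x]]] x
    by (simp add: adjoint_def arr_map_Id G0_in obj_map_in unit_in target.Comp_Id_left
        target.Comp_Id_right)
next
  fix x y f assume "x \<in> Ob D" "y \<in> Ob D" "f \<in> Hom D x y"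
  then show "arr_map adjoint x y f \<in> Hom C (obj_map adjoint x) (obj_map adjoint y)"
    by (simp add: arr_map_adjoint_in)
next
  fix x y z f g
  assume xyz: "x \<in> Ob D" "y \<in> Ob D" "z \<in> Ob D" and f: "f \<in> Hom D x y" and g: "g \<in> Hom D y z"
  let ?Gf = "arr_map adjoint x y f" and ?Gg = "arr_map adjoint y z g"
  let ?F = "obj_map F" and ?G = "obj_map adjoint"
  let ?FG = "\<lambda>x. obj_map F (G\<^sub>0 x)"
  note ob = xyz G0_in[OF xyz(1)] G0_in[OF xyz(2)] G0_in[OF xyz(3)]
    xyz[THEN G0_in, THEN obj_map_in]
  note Gf = arr_map_adjoint_in[OF xyz(1,2) f] and Gg = arr_map_adjoint_in[OF xyz(2,3) g]
  note FGf = arr_map_in[OF ob(4,5) Gf] and FGg = arr_map_in[OF ob(5,6) Gg]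
  let ?h = "Comp C (G\<^sub>0 x) (G\<^sub>0 y) (G\<^sub>0 z) ?Gg ?Gf"
  have h: "?h \<in> Hom C (G\<^sub>0 x) (G\<^sub>0 z)"
    by (rule source.Comp_in[OF ob(4-6) Gf Gg])
  \<comment> \<open>The naturality square of the unit is applied first for \<open>f\<close> and then
    for \<open>g\<close>, which moves \<open>\<eta>\<close> from the right end of the composite to
    the left end.\<close>
  have "Comp D x (?FG x) (?FG z) (arr_map F (G\<^sub>0 x) (G\<^sub>0 z) ?h) (\<eta> x) =
      Comp D x (?FG y) (?FG z) (arr_map F (G\<^sub>0 y) (G\<^sub>0 z) ?Gg)
        (Comp D x (?FG x) (?FG y) (arr_map F (G\<^sub>0 x) (G\<^sub>0 y) ?Gf) (\<eta> x))"
    unfolding arr_map_Comp[OF ob(4-6) Gf Gg]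
    by (rule target.Comp_assoc[OF ob(1,7-9) unit_in[OF xyz(1)] FGf FGg])
  also have "\<dots> = Comp D x (?FG y) (?FG z) (arr_map F (G\<^sub>0 y) (G\<^sub>0 z) ?Gg)
      (Comp D x y (?FG y) (\<eta> y) f)"
    by (simp add: unit_natural xyz f)
  also have "\<dots> = Comp D x y (?FG z)
      (Comp D y (?FG y) (?FG z) (arr_map F (G\<^sub>0 y) (G\<^sub>0 z) ?Gg) (\<eta> y)) f"
    by (rule target.Comp_assoc[OF ob(1,2,8,9) f unit_in[OF xyz(2)] FGg, symmetric])
  also have "\<dots> = Comp D x y (?FG z) (Comp D y z (?FG z) (\<eta> z) g) f"
    by (simp add: unit_natural xyz g)
  also have "\<dots> = Comp D x z (?FG z) (\<eta> z) (Comp D x y z g f)"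
    by (rule target.Comp_assoc[OF xyz ob(9) f g unit_in[OF xyz(3)]])
  finally show "arr_map adjoint x z (Comp D x y z g f) = Comp C (?G x) (?G y) (?G z) ?Gg ?Gf"
    using lift_unique[OF ob(1,6) h] by (simp add: adjoint_def)
qed

text \<open>The Hom bijection is composition with the unit, \<open>?\<Phi>\<close>, and its inverse
  is \<open>lift\<close>.\<close>

lemma left_adjoint_adjoint: "left_adjoint C D F adjoint"
proof -
  let ?\<Phi> = "\<lambda>x y h. Comp D x (obj_map F (G\<^sub>0 x)) (obj_map F y) (arr_map F (G\<^sub>0 x) y h) (\<eta> x)"
  have "adjunction C D F adjoint ?\<Phi>"
  proof (intro adjunction.intro adjunction_axioms.intro)
    show "is_functor C D F" by unfold_locales
    show "is_functor D C adjoint" by (rule is_functor_adjoint)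
  next
    fix x y assume x: "x \<in> Ob D" and y: "y \<in> Ob C"
    have "?\<Phi> x y h \<in> Hom D x (obj_map F y)" if "h \<in> Hom C (G\<^sub>0 x) y" for h
      by (rule target.Comp_in[OF x obj_map_in[OF G0_in[OF x]] obj_map_in[OF y] unit_in[OF x]
            arr_map_in[OF G0_in[OF x] y that]])
    then show "bij_betw (?\<Phi> x y) (Hom C (obj_map adjoint x) y) (Hom D x (obj_map F y))"
      by (intro bij_betw_byWitness[where f' = "lift x y"])
        (auto simp: lift_unit lift_unique x y intro: lift_in)
  next
    fix x x' y y' a h b
    assume x: "x \<in> Ob D" "x' \<in> Ob D" and y: "y \<in> Ob C" "y' \<in> Ob C"
      and a: "a \<in> Hom D x' x" and "h \<in> Hom C (obj_map adjoint x) y" and b: "b \<in> Hom C y y'"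
    then have h: "h \<in> Hom C (G\<^sub>0 x) y" by simp
    let ?Ga = "arr_map adjoint x' x a" and ?F = "obj_map F"
    let ?FG = "\<lambda>x. obj_map F (G\<^sub>0 x)"
    note ob = x[THEN G0_in] x[THEN G0_in, THEN obj_map_in] y[THEN obj_map_in]
    note Ga = arr_map_adjoint_in[OF x(2,1) a]
    note Fa = arr_map_in[OF ob(2,1) Ga] and Fh = arr_map_in[OF ob(1) y(1) h]
      and Fb = arr_map_in[OF y b]
    have hGa: "Comp C (G\<^sub>0 x') (G\<^sub>0 x) y h ?Ga \<in> Hom C (G\<^sub>0 x') y"
      by (rule source.Comp_in[OF ob(2,1) y(1) Ga h])
    \<comment> \<open>Functoriality of \<open>F\<close> splits off \<open>b\<close>; the remaining
      composite is handled next by naturality of the unit at \<open>a\<close>.\<close>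
    have "?\<Phi> x' y' (Comp C (G\<^sub>0 x') y y' b (Comp C (G\<^sub>0 x') (G\<^sub>0 x) y h ?Ga)) =
        Comp D x' (?F y) (?F y') (arr_map F y y' b)
          (Comp D x' (?FG x') (?F y) (arr_map F (G\<^sub>0 x') y (Comp C (G\<^sub>0 x') (G\<^sub>0 x) y h ?Ga)) (\<eta> x'))"
      unfolding arr_map_Comp[OF ob(2) y hGa b]
      by (rule target.Comp_assoc[OF x(2) ob(4,5,6) unit_in[OF x(2)] arr_map_in[OF ob(2) y(1) hGa] Fb])
    also have "Comp D x' (?FG x') (?F y) (arr_map F (G\<^sub>0 x') y (Comp C (G\<^sub>0 x') (G\<^sub>0 x) y h ?Ga)) (\<eta> x') =
        Comp D x' (?FG x) (?F y) (arr_map F (G\<^sub>0 x) y h) (Comp D x' x (?FG x) (\<eta> x) a)"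
      unfolding arr_map_Comp[OF ob(2,1) y(1) Ga h] unit_natural[OF x(2,1) a, symmetric]
      by (rule target.Comp_assoc[OF x(2) ob(4,3,5) unit_in[OF x(2)] Fa Fh])
    also have "\<dots> = Comp D x' x (?F y) (?\<Phi> x y h) a"
      by (rule target.Comp_assoc[OF x(2,1) ob(3,5) a unit_in[OF x(1)] Fh, symmetric])
    finally show "?\<Phi> x' y' (Comp C (obj_map adjoint x') y y' b
          (Comp C (obj_map adjoint x') (obj_map adjoint x) y h ?Ga)) =
        Comp D x' (?F y) (?F y') (arr_map F y y' b) (Comp D x' x (?F y) (?\<Phi> x y h) a)"
      by simp
  qed
  then show ?thesis unfolding left_adjoint_def by blast
qed

end


section \<open>Leibniz algebras\<close>

lemma module_homI:
  assumes "\<And>x. x \<in> carrier M \<Longrightarrow> f x \<in> carrier N"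
    and "\<And>x y. \<lbrakk>x \<in> carrier M; y \<in> carrier M\<rbrakk> \<Longrightarrow> f (x \<oplus>\<^bsub>M\<^esub> y) = f x \<oplus>\<^bsub>N\<^esub> f y"
    and "\<And>a x. \<lbrakk>a \<in> carrier K; x \<in> carrier M\<rbrakk> \<Longrightarrow> f (a \<odot>\<^bsub>M\<^esub> x) = a \<odot>\<^bsub>N\<^esub> f x"
  shows "f \<in> module_hom K M N"
  using assms by (simp add: LinearCombinations.module_hom_def)

lemma module_hom_in: "\<lbrakk>f \<in> module_hom K M N; x \<in> carrier M\<rbrakk> \<Longrightarrow> f x \<in> carrier N"
  by (auto simp: LinearCombinations.module_hom_def)

lemma module_hom_zero:
  assumes "Module.module K M" "Module.module K N" "f \<in> module_hom K M N"
  shows "f \<zero>\<^bsub>M\<^esub> = \<zero>\<^bsub>N\<^esub>"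
  using assms by (intro mod_hom.f0_is_0) (simp add: mod_hom_def mod_hom_axioms_def)

lemma module_hom_uminus:
  assumes "Module.module K M" "Module.module K N" "f \<in> module_hom K M N" "x \<in> carrier M"
  shows "f (\<ominus>\<^bsub>M\<^esub> x) = \<ominus>\<^bsub>N\<^esub> f x"
  using assms by (intro mod_hom.f_neg) (simp_all add: mod_hom_def mod_hom_axioms_def)

lemma restrict_module_hom:
  assumes "Module.module K M" "f \<in> module_hom K M N"
  shows "restrict f (carrier M) \<in> module_hom K M N"
proof -
  interpret Module.module K M by fact
  show ?thesis using assms(2) by (auto simp: LinearCombinations.module_hom_def)
qed

lemma comp_module_hom:
  assumes "f \<in> module_hom K L M" "g \<in> module_hom K M N"
  shows "g \<circ> f \<in> module_hom K L N"
  using assms by (auto simp: LinearCombinations.module_hom_def Pi_iff)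

lemma comp_bracket_hom:
  assumes "f \<in> bracket_hom K L M" "g \<in> bracket_hom K M N"
  shows "g \<circ> f \<in> bracket_hom K L N"
  using assms by (auto simp: bracket_hom_def comp_module_hom module_hom_in)

lemma bilinear_onD:
  assumes "bilinear_on K A B C f"
  shows "x \<in> carrier A \<Longrightarrow> f x \<in> module_hom K B C"
    and "y \<in> carrier B \<Longrightarrow> (\<lambda>x. f x y) \<in> module_hom K A C"
    and "\<lbrakk>x \<in> carrier A; y \<in> carrier B\<rbrakk> \<Longrightarrow> f x y \<in> carrier C"
  using assms by (auto simp: bilinear_on_def module_hom_in)

text \<open>The common core of Lie and Leibniz algebras. The calculation rules are proved here so
  that they are also available for a quotient whose bracket is known to be bilinear but whose
  identities are still to be proved.\<close>

locale bracket_module = Module.module K \<gg>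
  for K :: "('k, 'r) ring_scheme" (structure) and \<gg> :: "('k, 'g) bracket_space" +
  assumes bilinear: "bilinear_on K \<gg> \<gg> \<gg> (bracket \<gg>)"
begin

lemma bracket_closed [simp, intro]:
  "\<lbrakk>x \<in> carrier \<gg>; y \<in> carrier \<gg>\<rbrakk> \<Longrightarrow> bracket \<gg> x y \<in> carrier \<gg>"
  by (rule bilinear_onD(3)[OF bilinear])

lemma bracket_add_right:
  "\<lbrakk>x \<in> carrier \<gg>; y \<in> carrier \<gg>; z \<in> carrier \<gg>\<rbrakk>
    \<Longrightarrow> bracket \<gg> x (y \<oplus>\<^bsub>\<gg>\<^esub> z) = bracket \<gg> x y \<oplus>\<^bsub>\<gg>\<^esub> bracket \<gg> x z"
  by (rule LinearCombinations.module_hom_add[OF bilinear_onD(1)[OF bilinear]])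

lemma bracket_add_left:
  "\<lbrakk>x \<in> carrier \<gg>; y \<in> carrier \<gg>; z \<in> carrier \<gg>\<rbrakk>
    \<Longrightarrow> bracket \<gg> (x \<oplus>\<^bsub>\<gg>\<^esub> y) z = bracket \<gg> x z \<oplus>\<^bsub>\<gg>\<^esub> bracket \<gg> y z"
  by (rule LinearCombinations.module_hom_add[OF bilinear_onD(2)[OF bilinear]])

lemma bracket_smult_right:
  "\<lbrakk>a \<in> carrier K; x \<in> carrier \<gg>; y \<in> carrier \<gg>\<rbrakk>
    \<Longrightarrow> bracket \<gg> x (a \<odot>\<^bsub>\<gg>\<^esub> y) = a \<odot>\<^bsub>\<gg>\<^esub> bracket \<gg> x y"
  by (rule module_hom_smult[OF bilinear_onD(1)[OF bilinear]])

lemma bracket_smult_left: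
  "\<lbrakk>a \<in> carrier K; x \<in> carrier \<gg>; y \<in> carrier \<gg>\<rbrakk>
    \<Longrightarrow> bracket \<gg> (a \<odot>\<^bsub>\<gg>\<^esub> x) y = a \<odot>\<^bsub>\<gg>\<^esub> bracket \<gg> x y"
  by (rule module_hom_smult[OF bilinear_onD(2)[OF bilinear]])

lemma bracket_zero_left:
  "x \<in> carrier \<gg> \<Longrightarrow> bracket \<gg> \<zero>\<^bsub>\<gg>\<^esub> x = \<zero>\<^bsub>\<gg>\<^esub>"
  by (rule module_hom_zero[OF module_axioms module_axioms bilinear_onD(2)[OF bilinear]])

lemma bracket_zero_right:
  "x \<in> carrier \<gg> \<Longrightarrow> bracket \<gg> x \<zero>\<^bsub>\<gg>\<^esub> = \<zero>\<^bsub>\<gg>\<^esub>"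
  by (rule module_hom_zero[OF module_axioms module_axioms bilinear_onD(1)[OF bilinear]])

lemma bracket_uminus_right:
  "\<lbrakk>x \<in> carrier \<gg>; y \<in> carrier \<gg>\<rbrakk> \<Longrightarrow> bracket \<gg> x (\<ominus>\<^bsub>\<gg>\<^esub> y) = \<ominus>\<^bsub>\<gg>\<^esub> bracket \<gg> x y"
  by (rule module_hom_uminus[OF module_axioms module_axioms bilinear_onD(1)[OF bilinear]])

text \<open>Polarisation: a symmetrised bracket is a linear combination of squares. It gives
  antisymmetry when squares vanish, and later shows that the span of the squares is stable under
  left multiplication.\<close>

lemma bracket_square_add:
  assumes "x \<in> carrier \<gg>" "y \<in> carrier \<gg>"
  shows "bracket \<gg> x y \<oplus>\<^bsub>\<gg>\<^esub> bracket \<gg> y x =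
    bracket \<gg> (x \<oplus>\<^bsub>\<gg>\<^esub> y) (x \<oplus>\<^bsub>\<gg>\<^esub> y) \<ominus>\<^bsub>\<gg>\<^esub> (bracket \<gg> x x \<oplus>\<^bsub>\<gg>\<^esub> bracket \<gg> y y)"
proof -
  have "bracket \<gg> (x \<oplus>\<^bsub>\<gg>\<^esub> y) (x \<oplus>\<^bsub>\<gg>\<^esub> y) =
      (bracket \<gg> x y \<oplus>\<^bsub>\<gg>\<^esub> bracket \<gg> y x) \<oplus>\<^bsub>\<gg>\<^esub> (bracket \<gg> x x \<oplus>\<^bsub>\<gg>\<^esub> bracket \<gg> y y)"
    using assms by (simp add: bracket_add_left bracket_add_right M.a_ac)
  then show ?thesis
    using assms by (simp add: a_minus_def M.a_assoc M.r_neg)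
qed

lemma alternating_imp_antisymmetric:
  assumes "\<And>x. x \<in> carrier \<gg> \<Longrightarrow> bracket \<gg> x x = \<zero>\<^bsub>\<gg>\<^esub>" and "x \<in> carrier \<gg>" "y \<in> carrier \<gg>"
  shows "bracket \<gg> y x = \<ominus>\<^bsub>\<gg>\<^esub> bracket \<gg> x y"
proof -
  have "bracket \<gg> y x \<oplus>\<^bsub>\<gg>\<^esub> bracket \<gg> x y = \<zero>\<^bsub>\<gg>\<^esub>"
    using bracket_square_add[OF assms(3,2)] assms by (simp add: a_minus_def)
  then show ?thesis using assms by (metis M.minus_equality bracket_closed)
qed

lemma restrict_bracket_hom:
  assumes "f \<in> bracket_hom K \<gg> \<hh>"
  shows "restrict f (carrier \<gg>) \<in> bracket_hom K \<gg> \<hh>"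
  using assms restrict_module_hom[OF module_axioms, of f \<hh>] by (auto simp: bracket_hom_def)

end

sublocale leibniz_algebra \<subseteq> bracket_module
  by unfold_locales (rule bracket_bilinear)

sublocale lie_algebra \<subseteq> bracket_module
  by unfold_locales (rule bracket_bilinear)

text \<open>Antisymmetry turns the cyclic Jacobi sum into the left Leibniz rule. This is what allows
  \<open>AO_to_RBO\<close> to regard a Lie algebra as a Leibniz algebra.\<close>

sublocale lie_algebra \<subseteq> leibniz_algebra
proof unfold_locales
  show "bilinear_on K \<gg> \<gg> \<gg> (bracket \<gg>)" by (rule bracket_bilinear)
  fix x y z assume xyz: "x \<in> carrier \<gg>" "y \<in> carrier \<gg>" "z \<in> carrier \<gg>"
  let ?a = "bracket \<gg> x (bracket \<gg> y z)"
  let ?b = "bracket \<gg> y (bracket \<gg> x z)" and ?c = "bracket \<gg> (bracket \<gg> x y) z"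
  have "?a \<oplus>\<^bsub>\<gg>\<^esub> \<ominus>\<^bsub>\<gg>\<^esub> ?b \<oplus>\<^bsub>\<gg>\<^esub> \<ominus>\<^bsub>\<gg>\<^esub> ?c = \<zero>\<^bsub>\<gg>\<^esub>"
    using jacobi[OF xyz] xyz alternating_imp_antisymmetric[OF alternating, of x z]
      alternating_imp_antisymmetric[OF alternating, of "bracket \<gg> x y" z]
    by (simp add: bracket_uminus_right)
  then have "?a \<ominus>\<^bsub>\<gg>\<^esub> (?c \<oplus>\<^bsub>\<gg>\<^esub> ?b) = \<zero>\<^bsub>\<gg>\<^esub>"
    using xyz by (simp add: a_minus_def M.minus_add M.a_ac)
  then show "?a = ?c \<oplus>\<^bsub>\<gg>\<^esub> ?b" using xyz by (simp add: M.minus_other_side)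
qed

text \<open>The same computation read backwards; it recognises the quotient as a Lie algebra once
  its squares vanish.\<close>

lemma (in leibniz_algebra) alternating_imp_lie_algebra:
  assumes alt: "\<And>x. x \<in> carrier \<gg> \<Longrightarrow> bracket \<gg> x x = \<zero>\<^bsub>\<gg>\<^esub>"
  shows "lie_algebra K \<gg>"
proof unfold_locales
  note anti = alternating_imp_antisymmetric[OF alt]
  fix x y z assume xyz: "x \<in> carrier \<gg>" "y \<in> carrier \<gg>" "z \<in> carrier \<gg>"
  have "bracket \<gg> y (bracket \<gg> z x) = \<ominus>\<^bsub>\<gg>\<^esub> bracket \<gg> y (bracket \<gg> x z)"
    using xyz anti[of x z] by (simp add: bracket_uminus_right)
  moreover have "bracket \<gg> z (bracket \<gg> x y) = \<ominus>\<^bsub>\<gg>\<^esub> bracket \<gg> (bracket \<gg> x y) z"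
    using xyz anti[of "bracket \<gg> x y" z] by simp
  ultimately show "bracket \<gg> x (bracket \<gg> y z) \<oplus>\<^bsub>\<gg>\<^esub> bracket \<gg> y (bracket \<gg> z x)
      \<oplus>\<^bsub>\<gg>\<^esub> bracket \<gg> z (bracket \<gg> x y) = \<zero>\<^bsub>\<gg>\<^esub>"
    using xyz by (simp add: left_leibniz[of x y z] M.a_assoc M.r_neg)
qed (use alt bilinear in auto)

section \<open>Transport of structure along surjections\<close>

text \<open>Every element of \<open>N\<close> has the form \<open>f u\<close>, so each axiom is the
  image of the same axiom in \<open>M\<close>. Preservation of zero is a hypothesis because
  additivity implies it only once \<open>N\<close> is known to be a group.\<close>

lemma module_surj_image:
  assumes "Module.module K M" and f: "f \<in> module_hom K M N"
    and surj: "f ` carrier M = carrier N" and f_zero: "f \<zero>\<^bsub>M\<^esub> = \<zero>\<^bsub>N\<^esub>"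
  shows "Module.module K N"
proof -
  interpret Module.module K M by fact
  \<comment> \<open>The homomorphism laws are reversed: operations of \<open>N\<close> are gathered
    inside one application of \<open>f\<close>, where the axioms of \<open>M\<close> apply.\<close>
  note [simp] = LinearCombinations.module_hom_add[OF f, symmetric]
    module_hom_smult[OF f, symmetric] f_zero[symmetric]
  have ex: "\<exists>x\<in>carrier M. y = f x" if "y \<in> carrier N" for y
    using that surj by blast
  have f_in [simp]: "f x \<in> carrier N" if "x \<in> carrier M" for x
    using that surj by blast
  show ?thesis
  proof (rule moduleI)
    show "cring K" by (rule R.is_cring)
    show "abelian_group N"
    proof (rule abelian_groupI)
      fix x assume "x \<in> carrier N"
      then obtain u where "u \<in> carrier M" "x = f u" using ex by blast
      then show "\<exists>y\<in>carrier N. y \<oplus>\<^bsub>N\<^esub> x = \<zero>\<^bsub>N\<^esub>"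
        by (intro bexI[of _ "f (\<ominus>\<^bsub>M\<^esub> u)"]) (simp_all add: M.l_neg)
    qed (auto dest!: ex simp: M.a_ac)
  qed (auto dest!: ex simp: smult_l_distr smult_r_distr smult_assoc1)
qed

lemma fin_dim_vectorspace_surj_image:
  assumes "fin_dim_vectorspace K M" and f: "f \<in> module_hom K M N"
    and surj: "f ` carrier M = carrier N" and f_zero: "f \<zero>\<^bsub>M\<^esub> = \<zero>\<^bsub>N\<^esub>"
  shows "fin_dim_vectorspace K N"
proof -
  interpret M: fin_dim_vectorspace K M by fact
  interpret N: vectorspace K N
    by (intro vectorspace.intro module_surj_image[OF M.module_axioms assms(2-)]) (rule M.field_axioms)
  have "linear_map K M N f"
    by unfold_locales (rule f)
  then show ?thesis
    using linear_map.surj_fin_dim[OF _ M.finite_dimensional surj] by unfold_locales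
qed

text \<open>The structure is built in stages: bilinear bracket, left Leibniz rule, and finally
  alternation, which is where \<open>square\<close> enters.\<close>

lemma lie_algebra_surj_image:
  assumes "leibniz_algebra K \<gg>" and f: "f \<in> bracket_hom K \<gg> \<hh>"
    and surj: "f ` carrier \<gg> = carrier \<hh>" and f_zero: "f \<zero>\<^bsub>\<gg>\<^esub> = \<zero>\<^bsub>\<hh>\<^esub>"
    and square: "\<And>x. x \<in> carrier \<gg> \<Longrightarrow> f (bracket \<gg> x x) = \<zero>\<^bsub>\<hh>\<^esub>"
  shows "lie_algebra K \<hh>"
proof -
  interpret leibniz_algebra K \<gg> by fact
  have hom: "f \<in> module_hom K \<gg> \<hh>" using f by (simp add: bracket_hom_def)
  interpret H: fin_dim_vectorspace K \<hh>
    by (rule fin_dim_vectorspace_surj_image[OF fin_dim_vectorspace_axioms hom surj f_zero])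
  have add: "f x \<oplus>\<^bsub>\<hh>\<^esub> f y = f (x \<oplus>\<^bsub>\<gg>\<^esub> y)" and br: "bracket \<hh> (f x) (f y) = f (bracket \<gg> x y)"
    if "x \<in> carrier \<gg>" "y \<in> carrier \<gg>" for x y
    using that f by (simp_all add: bracket_hom_def LinearCombinations.module_hom_add[OF hom])
  have smult: "a \<odot>\<^bsub>\<hh>\<^esub> f x = f (a \<odot>\<^bsub>\<gg>\<^esub> x)" if "a \<in> carrier K" "x \<in> carrier \<gg>" for a x
    using that by (simp add: module_hom_smult[OF hom])
  have ex: "\<exists>x\<in>carrier \<gg>. y = f x" if "y \<in> carrier \<hh>" for y
    using that surj by blast
  have f_in [simp]: "f x \<in> carrier \<hh>" if "x \<in> carrier \<gg>" for x
    using that surj by blast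
  interpret H: bracket_module K \<hh>
    by unfold_locales
      (auto simp: bilinear_on_def add br smult bracket_add_left bracket_add_right
        bracket_smult_left bracket_smult_right dest!: ex intro!: module_homI)
  interpret H: leibniz_algebra K \<hh>
  proof unfold_locales
    fix x y z assume "x \<in> carrier \<hh>" "y \<in> carrier \<hh>" "z \<in> carrier \<hh>"
    then obtain u v w where "u \<in> carrier \<gg>" "x = f u" "v \<in> carrier \<gg>" "y = f v"
      "w \<in> carrier \<gg>" "z = f w"
      using ex by metis
    then show "bracket \<hh> x (bracket \<hh> y z) =
        bracket \<hh> (bracket \<hh> x y) z \<oplus>\<^bsub>\<hh>\<^esub> bracket \<hh> y (bracket \<hh> x z)"
      by (simp add: add br left_leibniz[of u v w])
  qed (rule H.bilinear)
  show ?thesis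
    by (rule H.alternating_imp_lie_algebra) (auto simp: br square dest!: ex)
qed


section \<open>The Lie algebra associated with a Leibniz algebra\<close>

text \<open>The linear span of the squares. The inductive form reduces a property stable under
  linear combinations to the case of squares; negatives arise from the scalar -1.\<close>

inductive_set leibniz_kernel :: "('k, 'r) ring_scheme \<Rightarrow> ('k, 'g) bracket_space \<Rightarrow> 'g set"
  for K and \<gg> where
  zero: "\<zero>\<^bsub>\<gg>\<^esub> \<in> leibniz_kernel K \<gg>"
| square: "x \<in> carrier \<gg> \<Longrightarrow> bracket \<gg> x x \<in> leibniz_kernel K \<gg>"
| add: "\<lbrakk>x \<in> leibniz_kernel K \<gg>; y \<in> leibniz_kernel K \<gg>\<rbrakk> \<Longrightarrow> x \<oplus>\<^bsub>\<gg>\<^esub> y \<in> leibniz_kernel K \<gg>"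
| smult: "\<lbrakk>a \<in> carrier K; x \<in> leibniz_kernel K \<gg>\<rbrakk> \<Longrightarrow> a \<odot>\<^bsub>\<gg>\<^esub> x \<in> leibniz_kernel K \<gg>"

text \<open>In a Leibniz algebra the predicate under \<open>SOME\<close> depends only on the coset
  of \<open>x\<close>, so congruent elements receive the same representative.\<close>

definition leibniz_rep :: "('k, 'r) ring_scheme \<Rightarrow> ('k, 'g) bracket_space \<Rightarrow> 'g \<Rightarrow> 'g" where
  "leibniz_rep K \<gg> x = (SOME y. y \<in> carrier \<gg> \<and> y \<ominus>\<^bsub>\<gg>\<^esub> x \<in> leibniz_kernel K \<gg>)"

text \<open>The quotient by the Leibniz kernel lives on chosen representatives of the cosets, so that its
  elements have the same type as those of the original algebra.\<close>

definition lie_quotient ::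
  "('k, 'r) ring_scheme \<Rightarrow> ('k, 'g) bracket_space \<Rightarrow> ('k, 'g) bracket_space" where
  "lie_quotient K \<gg> = \<gg>\<lparr>
     carrier := leibniz_rep K \<gg> ` carrier \<gg>,
     zero := leibniz_rep K \<gg> \<zero>\<^bsub>\<gg>\<^esub>,
     add := (\<lambda>x y. leibniz_rep K \<gg> (x \<oplus>\<^bsub>\<gg>\<^esub> y)),
     smult := (\<lambda>a x. leibniz_rep K \<gg> (a \<odot>\<^bsub>\<gg>\<^esub> x)),
     bracket := (\<lambda>x y. leibniz_rep K \<gg> (bracket \<gg> x y))\<rparr>"

lemma lie_quotient_simps [simp]:
  "carrier (lie_quotient K \<gg>) = leibniz_rep K \<gg> ` carrier \<gg>"
  "\<zero>\<^bsub>lie_quotient K \<gg>\<^esub> = leibniz_rep K \<gg> \<zero>\<^bsub>\<gg>\<^esub>"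
  "x \<oplus>\<^bsub>lie_quotient K \<gg>\<^esub> y = leibniz_rep K \<gg> (x \<oplus>\<^bsub>\<gg>\<^esub> y)"
  "a \<odot>\<^bsub>lie_quotient K \<gg>\<^esub> x = leibniz_rep K \<gg> (a \<odot>\<^bsub>\<gg>\<^esub> x)"
  "bracket (lie_quotient K \<gg>) x y = leibniz_rep K \<gg> (bracket \<gg> x y)"
  by (simp_all add: lie_quotient_def)

lemma (in abelian_group) minus_add_minus:
  assumes "x \<in> carrier G" "y \<in> carrier G" "z \<in> carrier G"
  shows "(x \<ominus> y) \<oplus> (y \<ominus> z) = x \<ominus> z"
  using assms by (simp add: a_minus_def a_assoc r_neg1)

context leibniz_algebra
begin

section \<open>The Leibniz kernel is a two-sided ideal\<close>

lemma leibniz_kernel_closed: "x \<in> leibniz_kernel K \<gg> \<Longrightarrow> x \<in> carrier \<gg>"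
  by (induction rule: leibniz_kernel.induct) auto

lemma leibniz_kernel_uminus:
  assumes "x \<in> leibniz_kernel K \<gg>"
  shows "\<ominus>\<^bsub>\<gg>\<^esub> x \<in> leibniz_kernel K \<gg>"
proof -
  have "\<ominus>\<^bsub>\<gg>\<^esub> x = (\<ominus> \<one>) \<odot>\<^bsub>\<gg>\<^esub> x"
    using leibniz_kernel_closed[OF assms] by (simp add: smult_l_minus)
  also have "\<dots> \<in> leibniz_kernel K \<gg>"
    by (rule leibniz_kernel.smult[OF _ assms]) simp
  finally show ?thesis .
qed

lemma leibniz_kernel_minus:
  "\<lbrakk>x \<in> leibniz_kernel K \<gg>; y \<in> leibniz_kernel K \<gg>\<rbrakk> \<Longrightarrow> x \<ominus>\<^bsub>\<gg>\<^esub> y \<in> leibniz_kernel K \<gg>"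
  unfolding a_minus_def by (intro leibniz_kernel.add leibniz_kernel_uminus)

text \<open>The left Leibniz rule for \<open>x\<close>, \<open>x\<close>, \<open>y\<close> has
  \<open>bracket \<gg> x (bracket \<gg> x y)\<close> on both sides; cancelling it annihilates the
  square. Linearity gives the rest.\<close>

lemma bracket_leibniz_kernel_left:
  assumes "x \<in> leibniz_kernel K \<gg>" "y \<in> carrier \<gg>"
  shows "bracket \<gg> x y = \<zero>\<^bsub>\<gg>\<^esub>"
  using assms
proof (induction rule: leibniz_kernel.induct)
  case (square x)
  have "bracket \<gg> x (bracket \<gg> x y) = bracket \<gg> (bracket \<gg> x x) y \<oplus>\<^bsub>\<gg>\<^esub> bracket \<gg> x (bracket \<gg> x y)"
    by (rule left_leibniz[OF square(1,1,2)])
  then show ?case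
    using M.add.r_cancel_one'[of "bracket \<gg> x (bracket \<gg> x y)" "bracket \<gg> (bracket \<gg> x x) y"] square
    by auto
next
  case zero
  then show ?case by (rule bracket_zero_left)
next
  case (add u v)
  then show ?case using add.hyps[THEN leibniz_kernel_closed] by (simp add: bracket_add_left)
next
  case (smult a u)
  then show ?case using smult.hyps(2)[THEN leibniz_kernel_closed] by (simp add: bracket_smult_left)
qed

text \<open>On a square, the left Leibniz rule produces the symmetrised bracket of \<open>?z\<close>
  and \<open>x\<close>, which polarisation rewrites as a combination of squares.\<close>

lemma bracket_leibniz_kernel_right:
  assumes "x \<in> leibniz_kernel K \<gg>" "y \<in> carrier \<gg>"
  shows "bracket \<gg> y x \<in> leibniz_kernel K \<gg>"
  using assms
proof (induction rule: leibniz_kernel.induct)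
  case (square x)
  let ?z = "bracket \<gg> y x"
  have "bracket \<gg> y (bracket \<gg> x x) = bracket \<gg> ?z x \<oplus>\<^bsub>\<gg>\<^esub> bracket \<gg> x ?z"
    using square by (intro left_leibniz)
  also have "\<dots> \<in> leibniz_kernel K \<gg>"
    unfolding bracket_square_add[OF bracket_closed[OF \<open>y \<in> carrier \<gg>\<close> \<open>x \<in> carrier \<gg>\<close>] \<open>x \<in> carrier \<gg>\<close>]
    using square by (intro leibniz_kernel_minus leibniz_kernel.add leibniz_kernel.square) auto
  finally show ?case .
next
  case zero
  then show ?case by (simp add: bracket_zero_right leibniz_kernel.zero)
next
  case (add u v)
  then show ?case
    using add.hyps[THEN leibniz_kernel_closed] by (simp add: bracket_add_right leibniz_kernel.add)
next
  case (smult a u)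
  then show ?case
    using smult.hyps(2)[THEN leibniz_kernel_closed] by (simp add: bracket_smult_right leibniz_kernel.smult)
qed

section \<open>Coset representatives and the quotient map\<close>

lemma
  assumes "x \<in> carrier \<gg>"
  shows leibniz_rep_closed [simp, intro]: "leibniz_rep K \<gg> x \<in> carrier \<gg>"
    and leibniz_rep_minus: "leibniz_rep K \<gg> x \<ominus>\<^bsub>\<gg>\<^esub> x \<in> leibniz_kernel K \<gg>"
proof -
  \<comment> \<open>The element \<open>x\<close> itself witnesses that the choice is
    possible.\<close>
  have "x \<in> carrier \<gg> \<and> x \<ominus>\<^bsub>\<gg>\<^esub> x \<in> leibniz_kernel K \<gg>"
    using assms leibniz_kernel.zero[of \<gg> K] by (simp add: M.minus_other_side[THEN iffD2])
  then have "leibniz_rep K \<gg> x \<in> carrier \<gg> \<and> leibniz_rep K \<gg> x \<ominus>\<^bsub>\<gg>\<^esub> x \<in> leibniz_kernel K \<gg>"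
    unfolding leibniz_rep_def by (rule someI)
  then show "leibniz_rep K \<gg> x \<in> carrier \<gg>"
    and "leibniz_rep K \<gg> x \<ominus>\<^bsub>\<gg>\<^esub> x \<in> leibniz_kernel K \<gg>" by auto
qed

text \<open>The two choice predicates are equivalent, so the representatives are equal and not
  merely congruent.\<close>

lemma leibniz_rep_eqI:
  assumes "x \<in> carrier \<gg>" "y \<in> carrier \<gg>" and xy: "x \<ominus>\<^bsub>\<gg>\<^esub> y \<in> leibniz_kernel K \<gg>"
  shows "leibniz_rep K \<gg> x = leibniz_rep K \<gg> y"
proof -
  have yx: "y \<ominus>\<^bsub>\<gg>\<^esub> x \<in> leibniz_kernel K \<gg>"
    using leibniz_kernel_uminus[OF xy] assms by (simp add: a_minus_def M.minus_add M.a_comm)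
  have "z \<ominus>\<^bsub>\<gg>\<^esub> x \<in> leibniz_kernel K \<gg> \<longleftrightarrow> z \<ominus>\<^bsub>\<gg>\<^esub> y \<in> leibniz_kernel K \<gg>"
    if "z \<in> carrier \<gg>" for z
    using leibniz_kernel.add[OF _ xy, of "z \<ominus>\<^bsub>\<gg>\<^esub> x"] leibniz_kernel.add[OF _ yx, of "z \<ominus>\<^bsub>\<gg>\<^esub> y"]
    using that assms by (auto simp: M.minus_add_minus)
  then show ?thesis unfolding leibniz_rep_def by metis
qed

lemma leibniz_rep_idem [simp]:
  "x \<in> carrier \<gg> \<Longrightarrow> leibniz_rep K \<gg> (leibniz_rep K \<gg> x) = leibniz_rep K \<gg> x"
  by (intro leibniz_rep_eqI leibniz_rep_minus leibniz_rep_closed)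

lemma leibniz_rep_kernel:
  assumes "x \<in> leibniz_kernel K \<gg>"
  shows "leibniz_rep K \<gg> x = leibniz_rep K \<gg> \<zero>\<^bsub>\<gg>\<^esub>"
  using assms leibniz_kernel_closed[OF assms]
  by (intro leibniz_rep_eqI leibniz_kernel_minus leibniz_kernel.zero) auto

lemma leibniz_rep_add_eqI:
  assumes "x \<in> carrier \<gg>" "y \<in> carrier \<gg>" "k \<in> leibniz_kernel K \<gg>" "y = k \<oplus>\<^bsub>\<gg>\<^esub> x"
  shows "leibniz_rep K \<gg> y = leibniz_rep K \<gg> x"
  using assms leibniz_kernel_closed[OF assms(3)]
  by (intro leibniz_rep_eqI) (simp_all add: a_minus_def M.a_assoc M.r_neg)

text \<open>Writing a representative as \<open>x\<close> plus a kernel element turns compatibility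
  with each operation into an expansion whose correction term is absorbed by
  \<open>leibniz_rep_add_eqI\<close>.\<close>

lemma leibniz_rep_decomp:
  assumes "x \<in> carrier \<gg>"
  obtains k where "k \<in> leibniz_kernel K \<gg>" "leibniz_rep K \<gg> x = k \<oplus>\<^bsub>\<gg>\<^esub> x"
  using assms leibniz_rep_minus[OF assms]
  by (intro that[of "leibniz_rep K \<gg> x \<ominus>\<^bsub>\<gg>\<^esub> x"]) (auto simp: a_minus_def M.a_assoc M.l_neg)

lemma leibniz_rep_add:
  assumes xy: "x \<in> carrier \<gg>" "y \<in> carrier \<gg>"
  shows "leibniz_rep K \<gg> (leibniz_rep K \<gg> x \<oplus>\<^bsub>\<gg>\<^esub> leibniz_rep K \<gg> y) = leibniz_rep K \<gg> (x \<oplus>\<^bsub>\<gg>\<^esub> y)"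
proof -
  obtain k where k: "k \<in> leibniz_kernel K \<gg>" "leibniz_rep K \<gg> x = k \<oplus>\<^bsub>\<gg>\<^esub> x"
    using leibniz_rep_decomp[OF xy(1)] .
  obtain l where l: "l \<in> leibniz_kernel K \<gg>" "leibniz_rep K \<gg> y = l \<oplus>\<^bsub>\<gg>\<^esub> y"
    using leibniz_rep_decomp[OF xy(2)] .
  note [simp] = xy k(1)[THEN leibniz_kernel_closed] l(1)[THEN leibniz_kernel_closed]
  show ?thesis
    by (rule leibniz_rep_add_eqI[OF _ _ leibniz_kernel.add[OF k(1) l(1)]])
      (simp_all add: k(2) l(2) M.a_ac)
qed

lemma leibniz_rep_smult:
  assumes ax: "a \<in> carrier K" "x \<in> carrier \<gg>"
  shows "leibniz_rep K \<gg> (a \<odot>\<^bsub>\<gg>\<^esub> leibniz_rep K \<gg> x) = leibniz_rep K \<gg> (a \<odot>\<^bsub>\<gg>\<^esub> x)"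
proof -
  obtain k where k: "k \<in> leibniz_kernel K \<gg>" "leibniz_rep K \<gg> x = k \<oplus>\<^bsub>\<gg>\<^esub> x"
    using leibniz_rep_decomp[OF ax(2)] .
  note [simp] = ax k(1)[THEN leibniz_kernel_closed]
  show ?thesis
    by (rule leibniz_rep_add_eqI[OF _ _ leibniz_kernel.smult[OF ax(1) k(1)]])
      (simp_all add: k(2) smult_r_distr)
qed

text \<open>Expanding the bracket of \<open>k + x\<close> and \<open>l + y\<close>, the terms with
  \<open>k\<close> on the left vanish. The only correction is the bracket of \<open>x\<close> with
  \<open>l\<close>, which lies in the kernel.\<close>

lemma leibniz_rep_bracket:
  assumes xy: "x \<in> carrier \<gg>" "y \<in> carrier \<gg>"
  shows "leibniz_rep K \<gg> (bracket \<gg> (leibniz_rep K \<gg> x) (leibniz_rep K \<gg> y)) =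
    leibniz_rep K \<gg> (bracket \<gg> x y)"
proof -
  obtain k where k: "k \<in> leibniz_kernel K \<gg>" "leibniz_rep K \<gg> x = k \<oplus>\<^bsub>\<gg>\<^esub> x"
    using leibniz_rep_decomp[OF xy(1)] .
  obtain l where l: "l \<in> leibniz_kernel K \<gg>" "leibniz_rep K \<gg> y = l \<oplus>\<^bsub>\<gg>\<^esub> y"
    using leibniz_rep_decomp[OF xy(2)] .
  note [simp] = xy k(1)[THEN leibniz_kernel_closed] l(1)[THEN leibniz_kernel_closed]
  show ?thesis
    by (rule leibniz_rep_add_eqI[OF _ _ bracket_leibniz_kernel_right[OF l(1) xy(1)]])
      (simp_all add: k(2) l(2) bracket_add_left bracket_add_right bracket_leibniz_kernel_left[OF k(1)])
qed

lemma leibniz_rep_hom: "leibniz_rep K \<gg> \<in> bracket_hom K \<gg> (lie_quotient K \<gg>)"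
  by (auto simp: bracket_hom_def leibniz_rep_add leibniz_rep_smult leibniz_rep_bracket
      intro!: module_homI)

text \<open>The quotient map is surjective by the choice of carrier and sends squares to zero, so
  the transport result applies.\<close>

lemma lie_algebra_lie_quotient: "lie_algebra K (lie_quotient K \<gg>)"
  by (rule lie_algebra_surj_image[OF leibniz_algebra_axioms leibniz_rep_hom])
    (simp_all add: leibniz_rep_kernel[OF leibniz_kernel.square])

section \<open>Universal property of the quotient\<close>

text \<open>A linear map that kills squares kills the whole kernel, hence is constant on cosets. The
  target is an arbitrary module so that both algebra homomorphisms and the left action are
  covered.\<close>

lemma hom_leibniz_rep:
  assumes "Module.module K N" and f: "f \<in> module_hom K \<gg> N"
    and square: "\<And>x. x \<in> carrier \<gg> \<Longrightarrow> f (bracket \<gg> x x) = \<zero>\<^bsub>N\<^esub>" and "x \<in> carrier \<gg>"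
  shows "f (leibniz_rep K \<gg> x) = f x"
proof -
  interpret N: Module.module K N by fact
  have kernel: "f k = \<zero>\<^bsub>N\<^esub>" if "k \<in> leibniz_kernel K \<gg>" for k
    using that
    by induction (simp_all add: module_hom_zero[OF module_axioms \<open>Module.module K N\<close> f] square
      LinearCombinations.module_hom_add[OF f] module_hom_smult[OF f] leibniz_kernel_closed)
  obtain k where "k \<in> leibniz_kernel K \<gg>" "leibniz_rep K \<gg> x = k \<oplus>\<^bsub>\<gg>\<^esub> x"
    using leibniz_rep_decomp[OF \<open>x \<in> carrier \<gg>\<close>] .
  then show ?thesis
    using \<open>x \<in> carrier \<gg>\<close> by (simp add: LinearCombinations.module_hom_add[OF f] leibniz_kernel_closed kernel module_hom_in[OF f])
qed

text \<open>Representatives are elements of \<open>\<gg>\<close>, so the induced map is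
  \<open>f\<close> itself on the smaller carrier.\<close>

lemma module_hom_from_lie_quotient:
  assumes "Module.module K N" and f: "f \<in> module_hom K \<gg> N"
    and square: "\<And>x. x \<in> carrier \<gg> \<Longrightarrow> f (bracket \<gg> x x) = \<zero>\<^bsub>N\<^esub>"
  shows "f \<in> module_hom K (lie_quotient K \<gg>) N"
proof -
  note [simp] = hom_leibniz_rep[OF assms] module_hom_in[OF f]
    LinearCombinations.module_hom_add[OF f] module_hom_smult[OF f]
  show ?thesis by (rule module_homI) auto
qed

lemma bracket_hom_square:
  assumes "lie_algebra K \<hh>" "f \<in> bracket_hom K \<gg> \<hh>" "x \<in> carrier \<gg>"
  shows "f (bracket \<gg> x x) = \<zero>\<^bsub>\<hh>\<^esub>"
proof -
  interpret H: lie_algebra K \<hh> by fact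
  have "f x \<in> carrier \<hh>" using assms(2,3) by (auto simp: bracket_hom_def intro: module_hom_in)
  then show ?thesis using assms(2,3) by (simp add: bracket_hom_def H.alternating)
qed

lemma bracket_hom_leibniz_rep:
  assumes \<hh>: "lie_algebra K \<hh>" and f: "f \<in> bracket_hom K \<gg> \<hh>" and x: "x \<in> carrier \<gg>"
  shows "f (leibniz_rep K \<gg> x) = f x"
proof -
  interpret H: lie_algebra K \<hh> by fact
  have hom: "f \<in> module_hom K \<gg> \<hh>" using f by (simp add: bracket_hom_def)
  show ?thesis
    by (rule hom_leibniz_rep[OF H.module_axioms hom bracket_hom_square[OF \<hh> f] x])
qed

lemma bracket_hom_from_lie_quotient:
  assumes \<hh>: "lie_algebra K \<hh>" and f: "f \<in> bracket_hom K \<gg> \<hh>"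
  shows "f \<in> bracket_hom K (lie_quotient K \<gg>) \<hh>"
proof -
  interpret H: lie_algebra K \<hh> by fact
  have "f \<in> module_hom K \<gg> \<hh>" using f by (simp add: bracket_hom_def)
  from module_hom_from_lie_quotient[OF H.module_axioms this bracket_hom_square[OF \<hh> f]]
  have "f \<in> module_hom K (lie_quotient K \<gg>) \<hh>" .
  moreover have "f (bracket (lie_quotient K \<gg>) x y) = bracket \<hh> (f x) (f y)"
    if xy: "x \<in> carrier (lie_quotient K \<gg>)" "y \<in> carrier (lie_quotient K \<gg>)" for x y
  proof -
    have "x \<in> carrier \<gg>" "y \<in> carrier \<gg>" using xy by auto
    then show ?thesis using f by (simp add: bracket_hom_leibniz_rep[OF assms] bracket_hom_def)
  qed
  ultimately show ?thesis unfolding bracket_hom_def by blast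
qed

end


section \<open>The two categories\<close>

lemma (in bracket_module) id_bracket_hom: "(\<lambda>x\<in>carrier \<gg>. x) \<in> bracket_hom K \<gg> \<gg>"
  by (rule restrict_bracket_hom) (simp add: bracket_hom_def LinearCombinations.module_hom_def)

lemma (in bracket_module) compose_bracket_hom:
  assumes "f \<in> bracket_hom K \<gg> M" "g \<in> bracket_hom K M N"
  shows "compose (carrier \<gg>) g f \<in> bracket_hom K \<gg> N"
  using restrict_bracket_hom[OF comp_bracket_hom[OF assms]] by (simp add: compose_def comp_def)

lemma id_module_hom: "Module.module K M \<Longrightarrow> (\<lambda>x\<in>carrier M. x) \<in> module_hom K M M"
  by (rule restrict_module_hom) (simp_all add: LinearCombinations.module_hom_def)

lemma compose_module_hom:
  assumes "Module.module K L" "f \<in> module_hom K L M" "g \<in> module_hom K M N"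
  shows "compose (carrier L) g f \<in> module_hom K L N"
  using restrict_module_hom[OF assms(1) comp_module_hom[OF assms(2,3)]]
  by (simp add: compose_def comp_def)

lemma antisym_rota_baxter_operatorD:
  assumes "antisym_rota_baxter_operator K B"
  shows "leibniz_algebra K (rb_alg B)" and "bracket_module K (rb_alg B)"
    and "Module.module K (rb_mod B)"
    and "bilinear_on K (rb_alg B) (rb_mod B) (rb_mod B) (rb_rhoL B)"
    and "bilinear_on K (rb_alg B) (rb_mod B) (rb_mod B) (rb_rhoR B)"
    and "rb_op B \<in> module_hom K (rb_mod B) (rb_alg B)"
proof -
  interpret antisymmetric_representation K "rb_alg B" "rb_mod B" "rb_rhoL B" "rb_rhoR B"
    using assms by (simp add: antisym_rota_baxter_operator_def)
  show "leibniz_algebra K (rb_alg B)" "bracket_module K (rb_alg B)" "Module.module K (rb_mod B)"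
    by unfold_locales
  show "bilinear_on K (rb_alg B) (rb_mod B) (rb_mod B) (rb_rhoL B)" by (rule rhoL_bilinear)
  show "bilinear_on K (rb_alg B) (rb_mod B) (rb_mod B) (rb_rhoR B)" by (rule rhoR_bilinear)
  show "rb_op B \<in> module_hom K (rb_mod B) (rb_alg B)"
    using assms by (simp add: antisym_rota_baxter_operator_def)
qed

lemma rota_baxter_homD:
  assumes "f \<in> rota_baxter_hom K B B'"
  shows "fst f \<in> bracket_hom K (rb_alg B) (rb_alg B')" "fst f \<in> extensional (carrier (rb_alg B))"
    and "snd f \<in> module_hom K (rb_mod B) (rb_mod B')" "snd f \<in> extensional (carrier (rb_mod B))"
    and "u \<in> carrier (rb_mod B) \<Longrightarrow> rb_op B' (snd f u) = fst f (rb_op B u)"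
    and "\<lbrakk>x \<in> carrier (rb_alg B); u \<in> carrier (rb_mod B)\<rbrakk>
      \<Longrightarrow> snd f (rb_rhoL B x u) = rb_rhoL B' (fst f x) (snd f u)"
    and "\<lbrakk>x \<in> carrier (rb_alg B); u \<in> carrier (rb_mod B)\<rbrakk>
      \<Longrightarrow> snd f (rb_rhoR B x u) = rb_rhoR B' (fst f x) (snd f u)"
    and "x \<in> carrier (rb_alg B) \<Longrightarrow> fst f x \<in> carrier (rb_alg B')"
    and "u \<in> carrier (rb_mod B) \<Longrightarrow> snd f u \<in> carrier (rb_mod B')"
  using assms by (auto simp: rota_baxter_hom_def bracket_hom_def intro: module_hom_in)

lemma rota_baxter_homI:
  assumes "fst f \<in> bracket_hom K (rb_alg B) (rb_alg B')" "fst f \<in> extensional (carrier (rb_alg B))"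
    and "snd f \<in> module_hom K (rb_mod B) (rb_mod B')" "snd f \<in> extensional (carrier (rb_mod B))"
    and "\<And>u. u \<in> carrier (rb_mod B) \<Longrightarrow> rb_op B' (snd f u) = fst f (rb_op B u)"
    and "\<And>x u. \<lbrakk>x \<in> carrier (rb_alg B); u \<in> carrier (rb_mod B)\<rbrakk>
      \<Longrightarrow> snd f (rb_rhoL B x u) = rb_rhoL B' (fst f x) (snd f u)"
    and "\<And>x u. \<lbrakk>x \<in> carrier (rb_alg B); u \<in> carrier (rb_mod B)\<rbrakk>
      \<Longrightarrow> snd f (rb_rhoR B x u) = rb_rhoR B' (fst f x) (snd f u)"
  shows "f \<in> rota_baxter_hom K B B'"
  using assms by (cases f) (simp add: rota_baxter_hom_def)

lemma pair_id_rota_baxter_hom: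
  assumes "antisym_rota_baxter_operator K B"
  shows "pair_id (rb_alg B) (rb_mod B) \<in> rota_baxter_hom K B B"
proof -
  note B = antisym_rota_baxter_operatorD[OF assms]
  show ?thesis
    using bracket_module.id_bracket_hom[OF B(2)] id_module_hom[OF B(3)]
    by (intro rota_baxter_homI)
      (simp_all add: pair_id_def bilinear_onD(3)[OF B(4)] bilinear_onD(3)[OF B(5)] module_hom_in[OF B(6)])
qed

lemma pair_comp_rota_baxter_hom:
  assumes "antisym_rota_baxter_operator K B"
    and f: "f \<in> rota_baxter_hom K B B'" and g: "g \<in> rota_baxter_hom K B' B''"
  shows "pair_comp (rb_alg B) (rb_mod B) g f \<in> rota_baxter_hom K B B''"
proof -
  note B = antisym_rota_baxter_operatorD[OF assms(1)]
  note f = rota_baxter_homD[OF f] and g = rota_baxter_homD[OF g]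
  show ?thesis
    using bracket_module.compose_bracket_hom[OF B(2) f(1) g(1)] compose_module_hom[OF B(3) f(3) g(3)]
    by (intro rota_baxter_homI)
      (simp_all add: pair_comp_def compose_def f(5-) g(5-)
        bilinear_onD(3)[OF B(4)] bilinear_onD(3)[OF B(5)] module_hom_in[OF B(6)])
qed

text \<open>The unit laws are equalities of functions because both components of a morphism are
  extensional; associativity uses that the first morphism maps carriers into carriers.\<close>

lemma category_RBOLeibnizA: "category (RBOLeibnizA K)"
proof
  fix B assume "B \<in> Ob (RBOLeibnizA K)"
  then show "Id (RBOLeibnizA K) B \<in> Hom (RBOLeibnizA K) B B"
    by (simp add: RBOLeibnizA_def pair_id_rota_baxter_hom)
next
  fix x y z f g
  assume "x \<in> Ob (RBOLeibnizA K)" "f \<in> Hom (RBOLeibnizA K) x y" "g \<in> Hom (RBOLeibnizA K) y z"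
  then show "Comp (RBOLeibnizA K) x y z g f \<in> Hom (RBOLeibnizA K) x z"
    by (simp add: RBOLeibnizA_def pair_comp_rota_baxter_hom)
next
  fix x y f assume "f \<in> Hom (RBOLeibnizA K) x y"
  then have f: "f \<in> rota_baxter_hom K x y" by (simp add: RBOLeibnizA_def)
  have maps: "fst f \<in> carrier (rb_alg x) \<rightarrow> carrier (rb_alg y)"
    "snd f \<in> carrier (rb_mod x) \<rightarrow> carrier (rb_mod y)"
    using rota_baxter_homD(8,9)[OF f] by auto
  show "Comp (RBOLeibnizA K) x x y f (Id (RBOLeibnizA K) x) = f"
    using maps rota_baxter_homD(2,4)[OF f]
    by (simp add: RBOLeibnizA_def pair_comp_def pair_id_def compose_Id)
  show "Comp (RBOLeibnizA K) x y y (Id (RBOLeibnizA K) y) f = f"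
    using maps rota_baxter_homD(2,4)[OF f]
    by (simp add: RBOLeibnizA_def pair_comp_def pair_id_def Id_compose)
next
  fix w x y z f g h
  assume "f \<in> Hom (RBOLeibnizA K) w x"
  then have f: "f \<in> rota_baxter_hom K w x" by (simp add: RBOLeibnizA_def)
  have "fst f \<in> carrier (rb_alg w) \<rightarrow> carrier (rb_alg x)"
    "snd f \<in> carrier (rb_mod w) \<rightarrow> carrier (rb_mod x)"
    using rota_baxter_homD(8,9)[OF f] by auto
  then show "Comp (RBOLeibnizA K) w x z (Comp (RBOLeibnizA K) x y z h g) f =
      Comp (RBOLeibnizA K) w y z h (Comp (RBOLeibnizA K) w x y g f)"
    by (simp add: RBOLeibnizA_def pair_comp_def compose_assoc)
qed

section \<open>Averaging operators inside the Rota-Baxter category\<close>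

lemma AO_to_RBO_simps [simp]:
  "rb_alg (obj_map AO_to_RBO A) = ao_alg A"
  "rb_mod (obj_map AO_to_RBO A) = ao_mod A"
  "rb_rhoL (obj_map AO_to_RBO A) = ao_rho A"
  "rb_rhoR (obj_map AO_to_RBO A) x u = \<zero>\<^bsub>ao_mod A\<^esub>"
  "rb_op (obj_map AO_to_RBO A) = ao_op A"
  "arr_map AO_to_RBO A A' f = f"
  by (simp_all add: AO_to_RBO_def)

lemma (in lie_representation) antisymmetric_representation_zero:
  "antisymmetric_representation K \<gg> V \<rho> (\<lambda>x v. \<zero>\<^bsub>V\<^esub>)"
proof -
  have [simp]: "\<ominus>\<^bsub>V\<^esub> \<zero>\<^bsub>V\<^esub> = \<zero>\<^bsub>V\<^esub>"
    by (rule V.minus_equality) simp_all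
  have [simp]: "\<rho> x \<zero>\<^bsub>V\<^esub> = \<zero>\<^bsub>V\<^esub>" if "x \<in> carrier \<gg>" for x
    by (rule module_hom_zero[OF V.module_axioms V.module_axioms bilinear_onD(1)[OF rho_bilinear that]])
  show ?thesis
  proof unfold_locales
    show "bilinear_on K \<gg> V V \<rho>" by (rule rho_bilinear)
    show "bilinear_on K \<gg> V V (\<lambda>x v. \<zero>\<^bsub>V\<^esub>)"
      by (simp add: bilinear_on_def LinearCombinations.module_hom_def)
  qed (simp_all add: rho_bracket a_minus_def)
qed

lemma AO_to_RBO_object:
  assumes "averaging_operator K A"
  shows "antisym_rota_baxter_operator K (obj_map AO_to_RBO A)"
proof -
  interpret lie_representation K "ao_alg A" "ao_mod A" "ao_rho A"
    using assms by (simp add: averaging_operator_def)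
  have "rb_rhoR (obj_map AO_to_RBO A) = (\<lambda>x v. \<zero>\<^bsub>ao_mod A\<^esub>)" by (simp add: fun_eq_iff)
  moreover have op: "ao_op A \<in> module_hom K (ao_mod A) (ao_alg A)"
    using assms by (simp add: averaging_operator_def)
  ultimately show ?thesis
    using assms antisymmetric_representation_zero
    by (simp add: antisym_rota_baxter_operator_def averaging_operator_def
        bilinear_onD(3)[OF rho_bilinear] module_hom_in[OF op])
qed

text \<open>With zero right actions, the additional condition on a Rota-Baxter morphism says that
  its linear part fixes zero, which is automatic. Hence the functor is fully faithful.\<close>

lemma averaging_hom_eq:
  assumes "averaging_operator K A" "averaging_operator K A'"
  shows "averaging_hom K A A' = rota_baxter_hom K (obj_map AO_to_RBO A) (obj_map AO_to_RBO A')"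
proof -
  have "Module.module K (ao_mod A)" "Module.module K (ao_mod A')"
    using assms[THEN AO_to_RBO_object, THEN antisym_rota_baxter_operatorD(3)] by simp_all
  then show ?thesis
    by (auto simp: averaging_hom_def rota_baxter_hom_def module_hom_zero)
qed

text \<open>Hom sets, identities and composition of \<open>AOLie K\<close> are those of
  \<open>RBOLeibnizA K\<close> at the image objects, so the category laws and the functor laws are
  inherited.\<close>

lemma AOLie_simps:
  "A \<in> Ob (AOLie K) \<longleftrightarrow> averaging_operator K A"
  "\<lbrakk>averaging_operator K A; averaging_operator K A'\<rbrakk> \<Longrightarrow>
    Hom (AOLie K) A A' = Hom (RBOLeibnizA K) (obj_map AO_to_RBO A) (obj_map AO_to_RBO A')"
  "Id (AOLie K) A = Id (RBOLeibnizA K) (obj_map AO_to_RBO A)"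
  "Comp (AOLie K) A A' A'' =
    Comp (RBOLeibnizA K) (obj_map AO_to_RBO A) (obj_map AO_to_RBO A') (obj_map AO_to_RBO A'')"
  by (simp_all add: AOLie_def RBOLeibnizA_def averaging_hom_eq)

lemma AO_to_RBO_in_Ob:
  "averaging_operator K A \<Longrightarrow> obj_map AO_to_RBO A \<in> Ob (RBOLeibnizA K)"
  by (simp add: RBOLeibnizA_def AO_to_RBO_object)

lemma category_AOLie: "category (AOLie K)"
proof -
  interpret category "RBOLeibnizA K" by (rule category_RBOLeibnizA)
  show ?thesis
    by unfold_locales
      (simp_all add: AOLie_simps AO_to_RBO_in_Ob Id_in Comp_in Comp_Id_left Comp_Id_right Comp_assoc)
qed

lemma is_functor_AO_to_RBO: "is_functor (AOLie K) (RBOLeibnizA K) AO_to_RBO"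
  by (intro is_functor.intro category_AOLie category_RBOLeibnizA is_functor_axioms.intro)
    (simp_all add: AOLie_simps AO_to_RBO_in_Ob)


section \<open>The left adjoint\<close>

text \<open>The action is left unchanged: elements of the quotient are elements of the original
  algebra, on which \<open>rb_rhoL B\<close> is already defined.\<close>

definition lie_quotient_op ::
  "('k, 'r) ring_scheme \<Rightarrow> ('k, 'g, 'v) rota_baxter_op \<Rightarrow> ('k, 'g, 'v) averaging_op" where
  "lie_quotient_op K B = \<lparr>ao_alg = lie_quotient K (rb_alg B), ao_mod = rb_mod B, ao_rho = rb_rhoL B,
     ao_op = leibniz_rep K (rb_alg B) \<circ> rb_op B\<rparr>"

definition lie_quotient_unit ::
  "('k, 'r) ring_scheme \<Rightarrow> ('k, 'g, 'v) rota_baxter_op \<Rightarrow> ('g \<Rightarrow> 'g) \<times> ('v \<Rightarrow> 'v)" where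
  "lie_quotient_unit K B =
     (restrict (leibniz_rep K (rb_alg B)) (carrier (rb_alg B)), (\<lambda>u\<in>carrier (rb_mod B). u))"

text \<open>Restricting to the representatives is how a map factors through the quotient.\<close>

definition lie_quotient_lift ::
  "('k, 'r) ring_scheme \<Rightarrow> ('k, 'g, 'v) rota_baxter_op
     \<Rightarrow> ('g \<Rightarrow> 'g) \<times> ('v \<Rightarrow> 'v) \<Rightarrow> ('g \<Rightarrow> 'g) \<times> ('v \<Rightarrow> 'v)" where
  "lie_quotient_lift K B f = (restrict (fst f) (carrier (lie_quotient K (rb_alg B))), snd f)"

lemma lie_quotient_op_simps [simp]:
  "ao_alg (lie_quotient_op K B) = lie_quotient K (rb_alg B)"
  "ao_mod (lie_quotient_op K B) = rb_mod B"
  "ao_rho (lie_quotient_op K B) = rb_rhoL B"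
  "ao_op (lie_quotient_op K B) = leibniz_rep K (rb_alg B) \<circ> rb_op B"
  by (simp_all add: lie_quotient_op_def)

context antisymmetric_representation
begin

lemma rhoL_closed: "\<lbrakk>x \<in> carrier \<gg>; v \<in> carrier V\<rbrakk> \<Longrightarrow> \<rho>L x v \<in> carrier V"
  by (rule bilinear_onD(3)[OF rhoL_bilinear])

text \<open>A square acts as the commutator of an operator with itself.\<close>

lemma rhoL_square:
  assumes "x \<in> carrier \<gg>" "v \<in> carrier V"
  shows "\<rho>L (bracket \<gg> x x) v = \<zero>\<^bsub>V\<^esub>"
  using assms by (simp add: rhoL_bracket rhoL_closed a_minus_def V.r_neg)

text \<open>For fixed \<open>v\<close>, the map \<open>\<lambda>x. \<rho>L x v\<close> is linear and
  kills squares, so it is constant on cosets: the left action descends.\<close>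

lemma rhoL_leibniz_rep:
  assumes "x \<in> carrier \<gg>" "v \<in> carrier V"
  shows "\<rho>L (leibniz_rep K \<gg> x) v = \<rho>L x v"
  using hom_leibniz_rep[OF V.module_axioms bilinear_onD(2)[OF rhoL_bilinear] rhoL_square] assms
  by simp

lemma lie_representation_lie_quotient: "lie_representation K (lie_quotient K \<gg>) V \<rho>L"
proof -
  interpret Q: lie_algebra K "lie_quotient K \<gg>" by (rule lie_algebra_lie_quotient)
  have sub: "x \<in> carrier \<gg>" if "x \<in> carrier (lie_quotient K \<gg>)" for x using that by auto
  show ?thesis
  proof unfold_locales
    show "bilinear_on K (lie_quotient K \<gg>) V V \<rho>L"
      unfolding bilinear_on_def
      using bilinear_onD(1)[OF rhoL_bilinear] sub
        module_hom_from_lie_quotient[OF V.module_axioms bilinear_onD(2)[OF rhoL_bilinear] rhoL_square]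
      by blast
  next
    fix x y v
    assume "x \<in> carrier (lie_quotient K \<gg>)" "y \<in> carrier (lie_quotient K \<gg>)" "v \<in> carrier V"
    then show "\<rho>L (bracket (lie_quotient K \<gg>) x y) v = \<rho>L x (\<rho>L y v) \<ominus>\<^bsub>V\<^esub> \<rho>L y (\<rho>L x v)"
      using sub[of x] sub[of y] by (simp del: lie_quotient_simps(1) add: rhoL_leibniz_rep rhoL_bracket)
  qed
qed

end

section \<open>The averaging operator on the quotient and its universal arrow\<close>

text \<open>Since the right action vanishes, the Rota-Baxter identity loses its second term.
  Applying the quotient map gives the averaging identity, because the left action does not
  distinguish an element from its representative.\<close>

lemma averaging_operator_lie_quotient_op:
  assumes "antisym_rota_baxter_operator K B"
  shows "averaging_operator K (lie_quotient_op K B)"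
proof -
  interpret antisymmetric_representation K "rb_alg B" "rb_mod B" "rb_rhoL B" "rb_rhoR B"
    using assms by (simp add: antisym_rota_baxter_operator_def)
  have op: "rb_op B \<in> module_hom K (rb_mod B) (rb_alg B)"
    by (rule antisym_rota_baxter_operatorD(6)[OF assms])
  have "leibniz_rep K (rb_alg B) \<circ> rb_op B \<in> module_hom K (rb_mod B) (lie_quotient K (rb_alg B))"
    using leibniz_rep_hom by (intro comp_module_hom[OF op]) (simp add: bracket_hom_def)
  moreover have "bracket (rb_alg B) (rb_op B u) (rb_op B v) = rb_op B (rb_rhoL B (rb_op B u) v)"
    if "u \<in> carrier (rb_mod B)" "v \<in> carrier (rb_mod B)" for u v
    using that assms
    by (simp add: antisym_rota_baxter_operator_def rhoR_zero rhoL_closed module_hom_in[OF op])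
  ultimately show ?thesis
    using lie_representation_lie_quotient
    by (simp add: averaging_operator_def leibniz_rep_bracket rhoL_leibniz_rep module_hom_in[OF op])
qed

lemma lie_quotient_unit_hom:
  assumes "antisym_rota_baxter_operator K B"
  shows "lie_quotient_unit K B \<in> rota_baxter_hom K B (obj_map AO_to_RBO (lie_quotient_op K B))"
proof -
  interpret antisymmetric_representation K "rb_alg B" "rb_mod B" "rb_rhoL B" "rb_rhoR B"
    using assms by (simp add: antisym_rota_baxter_operator_def)
  note op = antisym_rota_baxter_operatorD(6)[OF assms]
  show ?thesis
    using restrict_bracket_hom[OF leibniz_rep_hom] id_module_hom[OF V.module_axioms]
    by (intro rota_baxter_homI)
      (simp_all add: lie_quotient_unit_def rhoL_closed rhoL_leibniz_rep rhoR_zero module_hom_in[OF op])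
qed

lemma
  assumes B: "antisym_rota_baxter_operator K B" and A: "averaging_operator K A"
    and f: "f \<in> rota_baxter_hom K B (obj_map AO_to_RBO A)"
  shows lie_quotient_lift_hom: "lie_quotient_lift K B f \<in> averaging_hom K (lie_quotient_op K B) A"
    and lie_quotient_lift_unit:
      "pair_comp (rb_alg B) (rb_mod B) (lie_quotient_lift K B f) (lie_quotient_unit K B) = f"
proof -
  interpret antisymmetric_representation K "rb_alg B" "rb_mod B" "rb_rhoL B" "rb_rhoR B"
    using B by (simp add: antisym_rota_baxter_operator_def)
  interpret Q: lie_algebra K "lie_quotient K (rb_alg B)" by (rule lie_algebra_lie_quotient)
  interpret A: lie_representation K "ao_alg A" "ao_mod A" "ao_rho A"
    using A by (simp add: averaging_operator_def)
  note op = antisym_rota_baxter_operatorD(6)[OF B]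
  note f = rota_baxter_homD[OF f, simplified AO_to_RBO_simps]
  \<comment> \<open>A homomorphism into a Lie algebra kills squares, so restricting it to
    representatives loses no information.\<close>
  have rep [simp]: "fst f (leibniz_rep K (rb_alg B) x) = fst f x" if "x \<in> carrier (rb_alg B)" for x
    by (rule bracket_hom_leibniz_rep[OF A.lie_algebra_axioms f(1) that])
  have sub: "x \<in> carrier (rb_alg B)" if "x \<in> carrier (lie_quotient K (rb_alg B))" for x
    using that by auto
  \<comment> \<open>The morphism conditions are verified on the Rota-Baxter side and carried over by
    \<open>averaging_hom_eq\<close>.\<close>
  have "lie_quotient_lift K B f \<in>
      rota_baxter_hom K (obj_map AO_to_RBO (lie_quotient_op K B)) (obj_map AO_to_RBO A)"
  proof (rule rota_baxter_homI)
    show "fst (lie_quotient_lift K B f) \<in> bracket_hom K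
        (rb_alg (obj_map AO_to_RBO (lie_quotient_op K B))) (rb_alg (obj_map AO_to_RBO A))"
      using Q.restrict_bracket_hom[OF bracket_hom_from_lie_quotient[OF A.lie_algebra_axioms f(1)]]
      by (simp add: lie_quotient_lift_def)
    show "snd (lie_quotient_lift K B f) \<in> module_hom K
        (rb_mod (obj_map AO_to_RBO (lie_quotient_op K B))) (rb_mod (obj_map AO_to_RBO A))"
      using f(3) by (simp add: lie_quotient_lift_def)
  \<comment> \<open>The condition on right actions has zero on both sides, whence
    \<open>module_hom_zero\<close>.\<close>
  qed (use f(4-) sub module_hom_zero[OF V.module_axioms A.V.module_axioms f(3)] in
      \<open>auto simp: lie_quotient_lift_def module_hom_in[OF op] rhoL_leibniz_rep\<close>)
  then show "lie_quotient_lift K B f \<in> averaging_hom K (lie_quotient_op K B) A"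
    by (simp add: averaging_hom_eq averaging_operator_lie_quotient_op A B)
  have "compose (carrier (rb_alg B)) (restrict (fst f) (carrier (lie_quotient K (rb_alg B))))
      (restrict (leibniz_rep K (rb_alg B)) (carrier (rb_alg B))) = fst f"
    by (rule extensionalityI[OF compose_extensional f(2)]) (simp add: compose_def)
  moreover have "compose (carrier (rb_mod B)) (snd f) (\<lambda>u\<in>carrier (rb_mod B). u) = snd f"
    by (rule extensionalityI[OF compose_extensional f(4)]) (simp add: compose_def)
  ultimately show "pair_comp (rb_alg B) (rb_mod B) (lie_quotient_lift K B f) (lie_quotient_unit K B) = f"
    by (simp add: pair_comp_def lie_quotient_lift_def lie_quotient_unit_def)
qed

text \<open>On representatives the quotient map is the identity by \<open>leibniz_rep_idem\<close>,
  so composing with the unit and restricting returns \<open>h\<close>; elsewhere extensionality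
  fixes both sides.\<close>

lemma lie_quotient_lift_unique:
  assumes "leibniz_algebra K (rb_alg B)" and h: "h \<in> averaging_hom K (lie_quotient_op K B) A"
  shows "lie_quotient_lift K B (pair_comp (rb_alg B) (rb_mod B) h (lie_quotient_unit K B)) = h"
proof -
  interpret leibniz_algebra K "rb_alg B" by fact
  have ext: "fst h \<in> extensional (leibniz_rep K (rb_alg B) ` carrier (rb_alg B))"
    "snd h \<in> extensional (carrier (rb_mod B))"
    using h by (auto simp: averaging_hom_def)
  have "restrict (compose (carrier (rb_alg B)) (fst h)
      (restrict (leibniz_rep K (rb_alg B)) (carrier (rb_alg B))))
      (leibniz_rep K (rb_alg B) ` carrier (rb_alg B)) = fst h"
    by (rule extensionalityI[OF restrict_extensional ext(1)]) (auto simp: compose_def)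
  moreover have "compose (carrier (rb_mod B)) (snd h) (\<lambda>u\<in>carrier (rb_mod B). u) = snd h"
    by (rule extensionalityI[OF compose_extensional ext(2)]) (simp add: compose_def)
  ultimately show ?thesis
    by (simp add: pair_comp_def lie_quotient_lift_def lie_quotient_unit_def)
qed

lemma universal_arrows_lie_quotient:
  "universal_arrows (AOLie K) (RBOLeibnizA K) AO_to_RBO
    (lie_quotient_op K) (lie_quotient_unit K) (\<lambda>B A. lie_quotient_lift K B)"
  by (intro universal_arrows.intro is_functor_AO_to_RBO universal_arrows_axioms.intro)
    (simp_all add: AOLie_def RBOLeibnizA_def averaging_operator_lie_quotient_op
      lie_quotient_unit_hom lie_quotient_lift_hom lie_quotient_lift_unit
      lie_quotient_lift_unique antisym_rota_baxter_operatorD(1))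

theorem theorem2p12:
  fixes K :: "('k, 'r) ring_scheme"
  assumes "algebraically_closed K"
    and char_0: "\<And>n::nat. n > 0 \<Longrightarrow> [n] \<cdot>\<^bsub>K\<^esub> \<one>\<^bsub>K\<^esub> \<noteq> \<zero>\<^bsub>K\<^esub>"
  shows "is_functor (AOLie K) (RBOLeibnizA K)
           (AO_to_RBO :: (('k, 'g, 'v) averaging_op, ('g \<Rightarrow> 'g) \<times> ('v \<Rightarrow> 'v),
              ('k, 'g, 'v) rota_baxter_op, ('g \<Rightarrow> 'g) \<times> ('v \<Rightarrow> 'v)) functor_data) \<and>
         (\<exists>G :: (('k, 'g, 'v) rota_baxter_op, ('g \<Rightarrow> 'g) \<times> ('v \<Rightarrow> 'v),
              ('k, 'g, 'v) averaging_op, ('g \<Rightarrow> 'g) \<times> ('v \<Rightarrow> 'v)) functor_data.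
            is_functor (RBOLeibnizA K) (AOLie K) G \<and>
            left_adjoint (AOLie K) (RBOLeibnizA K) AO_to_RBO G)"
proof -
  \<comment> \<open>The witness for \<open>G\<close> is the functor \<open>adjoint\<close> of this
    interpretation, which is \<open>lie_quotient_op K\<close> on objects.\<close>
  interpret universal_arrows "AOLie K" "RBOLeibnizA K" AO_to_RBO
    "lie_quotient_op K" "lie_quotient_unit K" "\<lambda>B A. lie_quotient_lift K B"
    by (rule universal_arrows_lie_quotient)
  show ?thesis
    using is_functor_AO_to_RBO is_functor_adjoint left_adjoint_adjoint by blast
qed

end
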